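(* For $n$ given angles $0<a_i\le\pi$ ($i=1,\dots,n$) summing to $(n-2)\pi$, the $n$-gon with these angles circumscribed about the unit circle is uniquely perimeter minimizing for its area. Scaled to unit area, its perimeter is $$2\sqrt{\sum_{i=1}^n \cot(a_i/2)}.$$ Since cotangent is strictly convex up to $\pi/2$, the more nearly equal the angles, the smaller the perimeter.
   Context: The $a_i$ are the interior angles of a polygon in the plane, and the perimeter minimization is among $n$-gons with the given angles. An $n$-gon is circumscribed about the unit circle if the circle lies inside it and its sides are tangent to the circle. The last sentence of the claim refers to the perimeter of the circumscribed $n$-gon scaled to unit area. *)

theory Defs
  imports "HOL-Complex_Analysis.Complex_Analysis"
begin

text \<open>
  The plane is \<^typ>\<open>complex\<close>. A polygon is given by the list of its vertices in counterclockwise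
  cyclic order; indices are read modulo the length of the list.
\<close>

fun polygonal_path :: "complex list \<Rightarrow> real \<Rightarrow> complex" where
  "polygonal_path [] = linepath 0 0"
| "polygonal_path [a] = linepath a a"
| "polygonal_path [a, b] = linepath a b"
| "polygonal_path (a # b # c # vs) = linepath a b +++ polygonal_path (b # c # vs)"

definition boundary_path :: "complex list \<Rightarrow> real \<Rightarrow> complex" where
  "boundary_path vs = polygonal_path (vs @ [hd vs])"

definition next_vertex :: "complex list \<Rightarrow> nat \<Rightarrow> complex" where
  "next_vertex vs i = vs ! (Suc i mod length vs)"

definition prev_vertex :: "complex list \<Rightarrow> nat \<Rightarrow> complex" where
  "prev_vertex vs i = vs ! ((i + length vs - 1) mod length vs)"

text \<open>
  Neither convexity nor the value of the angle sum is built into the notion of an \<open>n\<close>-gon. The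
  winding number condition says that the vertices are listed counterclockwise. Straight angles
  are allowed, coinciding vertices are not.
\<close>

definition ngon :: "nat \<Rightarrow> complex list \<Rightarrow> bool" where
  "ngon n vs \<longleftrightarrow>
     n \<ge> 3 \<and> length vs = n \<and> simple_path (boundary_path vs) \<and>
     (\<forall>z \<in> inside (path_image (boundary_path vs)). winding_number (boundary_path vs) z = 1)"

definition polygon_region :: "complex list \<Rightarrow> complex set" where
  "polygon_region vs =
     path_image (boundary_path vs) \<union> inside (path_image (boundary_path vs))"

definition area :: "complex list \<Rightarrow> real" where
  "area vs = measure lebesgue (polygon_region vs)"

definition perimeter :: "complex list \<Rightarrow> real" where
  "perimeter vs = (\<Sum>i<length vs. dist (vs ! i) (next_vertex vs i))"

text \<open>
  Since the interior of a counterclockwise polygon lies to the left of its sides, the interior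
  angle at a vertex is swept out by turning counterclockwise from the outgoing side to the
  incoming one. It lies strictly between \<open>0\<close> and \<open>2 * pi\<close> for a simple polygon.
\<close>

definition interior_angle :: "complex list \<Rightarrow> nat \<Rightarrow> real" where
  "interior_angle vs i =
     Arg2pi ((prev_vertex vs i - vs ! i) / (next_vertex vs i - vs ! i))"

definition interior_angles :: "complex list \<Rightarrow> real list" where
  "interior_angles vs = map (interior_angle vs) [0..<length vs]"

text \<open>
  A side is tangent to a circle if its line meets the circle in exactly one point. The line
  rather than the segment is used because a vertex with a straight angle cuts a geometric side
  into several collinear pieces, and only some of these contain the point of contact. If all
  angles are less than \<open>pi\<close>, then, as the circle lies in the polygon, the point of contact lies
  on the side itself.
\<close>

definition circumscribed_about :: "complex list \<Rightarrow> complex \<Rightarrow> real \<Rightarrow> bool" where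
  "circumscribed_about vs c r \<longleftrightarrow>
     sphere c r \<subseteq> polygon_region vs \<and>
     (\<forall>i<length vs. \<exists>!z. z \<in> affine hull {vs ! i, next_vertex vs i} \<inter> sphere c r)"

text \<open>The position of the unit circle in the plane is irrelevant.\<close>

definition circumscribed_unit_circle :: "complex list \<Rightarrow> bool" where
  "circumscribed_unit_circle vs \<longleftrightarrow> (\<exists>c. circumscribed_about vs c 1)"

text \<open>
  Congruence of polygons as plane figures: the position of a vertex with a straight angle
  within a geometric side is not seen.
\<close>

definition congruent_polygons :: "complex list \<Rightarrow> complex list \<Rightarrow> bool" where
  "congruent_polygons vs ws \<longleftrightarrow>
     (\<exists>f :: complex \<Rightarrow> complex.
        (\<forall>x y. dist (f x) (f y) = dist x y) \<and> f ` polygon_region vs = polygon_region ws)"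

definition scale_to_unit_area :: "complex list \<Rightarrow> complex list" where
  "scale_to_unit_area vs = map (\<lambda>v. v /\<^sub>R sqrt (area vs)) vs"

definition admissible_angles :: "nat \<Rightarrow> real list \<Rightarrow> bool" where
  "admissible_angles n as \<longleftrightarrow>
     length as = n \<and> (\<forall>a \<in> set as. 0 < a \<and> a \<le> pi) \<and> sum_list as = (real n - 2) * pi"

text \<open>
  Being more nearly equal is strict majorization: for each \<open>k\<close> the \<open>k\<close> largest entries of \<open>as\<close>
  have at most the sum of the \<open>k\<close> largest entries of \<open>bs\<close>, the total sums agree, and the two
  lists are not rearrangements of each other.
\<close>

definition more_nearly_equal :: "real list \<Rightarrow> real list \<Rightarrow> bool" where
  "more_nearly_equal as bs \<longleftrightarrow>
     length as = length bs \<and> sum_list as = sum_list bs \<and>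
     (\<forall>k \<le> length as. sum_list (take k (rev (sort as))) \<le> sum_list (take k (rev (sort bs)))) \<and>
     mset as \<noteq> mset bs"

definition strictly_convex_on :: "real set \<Rightarrow> (real \<Rightarrow> real) \<Rightarrow> bool" where
  "strictly_convex_on S f \<longleftrightarrow>
     convex S \<and>
     (\<forall>x \<in> S. \<forall>y \<in> S. \<forall>t. x \<noteq> y \<and> 0 < t \<and> t < 1 \<longrightarrow>
        f ((1 - t) * x + t * y) < (1 - t) * f x + t * f y)"

end

theory Submission
  imports Defs
begin

text \<open>
  Since all angles are at most \<open>pi\<close>, the directions of the sides turn monotonically through one full
  turn, and this makes the polygon the intersection of the half-planes to the left of its sides. Its
  area is then a quadratic form in the side lengths \<open>l\<close>, namely one quarter of
  \<open>\<Sum>i j. l i * l j * sin \<bar>\<psi> i - \<psi> j\<bar>\<close>, where \<open>\<psi> i\<close> is the direction of side \<open>i\<close>. The polarisation of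
  this form against the side lengths \<open>t\<close> of the polygon \<open>T\<close> circumscribed about the unit circle with
  the same directions is twice the perimeter. So Lhuilier's inequality is the reversed Cauchy-Schwarz
  inequality for the form, and it follows once the form is nonpositive at \<open>l - r * t\<close> for some \<open>r\<close>.

  Let \<open>r\<close> equalise the widths of the polygon and of \<open>r T\<close> in one direction. Then the closed chain
  \<open>l - r * t\<close> splits into two chains, each of whose directions fill only a half-turn and whose ends have
  equal height. For directions in a half-turn, \<open>sin \<bar>a - b\<bar> = sin a * sin b * \<bar>cot a - cot b\<bar>\<close>, so
  nonpositivity reduces to the fact that \<open>\<bar>x - y\<bar>\<close> is a kernel of conditionally negative type. In the
  case of equality the signed lengths cancel in every direction, so the polygon is, up to vertices
  with straight angles, a translate of \<open>r T\<close>.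
\<close>

section \<open>A sign property of quadratic forms in the sine\<close>

text \<open>The lengths \<open>l - r * t\<close> are signed, so the chain to which the sign property
  is applied need not bound a region, and inequalities between areas of figures do not reach it;
  this is why area is turned into a quadratic form before anything is compared. Straight angles
  shape the rest. Sides may share a direction, so equality can only fix the total length in each
  direction, and congruence has to be read off the half-planes instead of the vertices. The polygon
  \<open>T\<close> may have sides of length zero, so it serves only as a vector of lengths, and a
  genuine circumscribed polygon with distinct vertices is built separately. For the inequality, two
  polygons with the same angles are never matched with each other: each is compared with the
  \<open>T\<close> of its own directions, whose perimeter is twice the sum of
  \<open>cot (a / 2)\<close> and so depends only on the multiset of angles.\<close>

lemma abs_kernel_step:
  fixes w :: "real \<Rightarrow> real"
  assumes "finite A" "\<forall>x\<in>A. x < b"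
  shows "(\<Sum>x\<in>A. \<Sum>y\<in>A. w x * w y * \<bar>x - y\<bar>) \<le> 2 * (\<Sum>x\<in>A. w x) * (\<Sum>x\<in>A. w x * (b - x)) \<and>
    ((\<Sum>x\<in>A. \<Sum>y\<in>A. w x * w y * \<bar>x - y\<bar>) = 2 * (\<Sum>x\<in>A. w x) * (\<Sum>x\<in>A. w x * (b - x)) \<longrightarrow>
       (\<forall>x\<in>A. w x = 0))"
  using assms
proof (induction A arbitrary: b rule: finite_linorder_max_induct)
  case empty
  then show ?case by simp
next
  case (insert m A)
  define S where "S = (\<Sum>x\<in>A. \<Sum>y\<in>A. w x * w y * \<bar>x - y\<bar>)"
  define W where "W = (\<Sum>x\<in>A. w x)"
  define T where "T = (\<Sum>x\<in>A. w x * (m - x))"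
  have IH: "S \<le> 2 * W * T" "S = 2 * W * T \<Longrightarrow> \<forall>x\<in>A. w x = 0"
    using insert.IH[of m] insert.hyps(2) unfolding S_def W_def T_def by blast+
  have mA: "m \<notin> A" using insert.hyps by auto
  have T1: "(\<Sum>x\<in>A. w x * w m * \<bar>x - m\<bar>) = w m * T"
    unfolding T_def sum_distrib_left
    by (rule sum.cong) (use insert.hyps in \<open>auto simp: abs_if mult_ac\<close>)
  have T2: "(\<Sum>y\<in>A. w m * w y * \<bar>m - y\<bar>) = w m * T"
    unfolding T_def sum_distrib_left
    by (rule sum.cong) (use insert.hyps in \<open>auto simp: abs_if mult_ac\<close>)
  have Tb: "(\<Sum>x\<in>A. w x * (b - x)) = T + W * (b - m)"
    unfolding T_def W_def sum_distrib_right sum.distrib[symmetric]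
    by (rule sum.cong) (auto simp: algebra_simps)
  have dbl: "(\<Sum>x\<in>insert m A. \<Sum>y\<in>insert m A. w x * w y * \<bar>x - y\<bar>) = S + 2 * w m * T"
    using mA insert.hyps by (simp add: sum.distrib T1 T2 S_def)
  have sW: "(\<Sum>x\<in>insert m A. w x) = W + w m"
    using mA insert.hyps by (simp add: W_def)
  have sT: "(\<Sum>x\<in>insert m A. w x * (b - x)) = T + (W + w m) * (b - m)"
    using mA insert.hyps(1) by (simp add: Tb) (simp add: algebra_simps)
  \<comment> \<open>Each new largest point adds a square: the gap between the two sides is twice the
    integral, up to \<open>b\<close>, of the squared running total of the weights. Equality
    therefore makes all running totals vanish.\<close>
  have diff: "2 * (W + w m) * (T + (W + w m) * (b - m)) - (S + 2 * w m * T)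
      = (2 * W * T - S) + 2 * (W + w m)\<^sup>2 * (b - m)"
    by (simp add: algebra_simps power2_eq_square)
  have bm: "b - m > 0" using insert.prems by auto
  have nn: "2 * (W + w m)\<^sup>2 * (b - m) \<ge> 0" using bm by simp
  have "\<forall>x\<in>insert m A. w x = 0"
    if "S + 2 * w m * T = 2 * (W + w m) * (T + (W + w m) * (b - m))"
  proof -
    have "S = 2 * W * T" "2 * (W + w m)\<^sup>2 * (b - m) = 0"
      using that diff nn IH(1) by linarith+
    then have *: "\<forall>x\<in>A. w x = 0" "W + w m = 0" using IH(2) bm by auto
    then have "W = 0" unfolding W_def by simp
    with * show ?thesis by auto
  qed
  then show ?case unfolding dbl sW sT using diff nn IH(1) by (smt (verit))
qed

text \<open>Several indices may share a value of \<open>x\<close>. Their weights are collected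
  first, so the case of equality yields only the vanishing of each collected weight.\<close>

lemma abs_kernel_neg:
  fixes f x :: "'a \<Rightarrow> real"
  assumes fin: "finite I" and zero: "(\<Sum>i\<in>I. f i) = 0"
  shows "(\<Sum>i\<in>I. \<Sum>j\<in>I. f i * f j * \<bar>x i - x j\<bar>) \<le> 0"
    and "(\<Sum>i\<in>I. \<Sum>j\<in>I. f i * f j * \<bar>x i - x j\<bar>) = 0 \<Longrightarrow> (\<Sum>i\<in>{i\<in>I. x i = y}. f i) = 0"
proof -
  define w where "w y = (\<Sum>i\<in>{i\<in>I. x i = y}. f i)" for y
  define A where "A = x ` I"
  have fA: "finite A" using fin by (simp add: A_def)
  have grp: "(\<Sum>y\<in>A. w y * h y) = (\<Sum>i\<in>I. f i * h (x i))" for h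
  proof -
    have "(\<Sum>y\<in>A. w y * h y) = (\<Sum>y\<in>A. \<Sum>i\<in>{i\<in>I. x i = y}. f i * h (x i))"
      by (simp add: w_def sum_distrib_right)
    also have "\<dots> = (\<Sum>i\<in>I. f i * h (x i))"
      by (rule sum.group) (use fin fA in \<open>auto simp: A_def\<close>)
    finally show ?thesis .
  qed
  have sumw: "(\<Sum>y\<in>A. w y) = 0" using grp[of "\<lambda>_. 1"] zero by simp
  have dbl: "(\<Sum>u\<in>A. \<Sum>v\<in>A. w u * w v * \<bar>u - v\<bar>) = (\<Sum>i\<in>I. \<Sum>j\<in>I. f i * f j * \<bar>x i - x j\<bar>)"
  proof -
    have "(\<Sum>u\<in>A. \<Sum>v\<in>A. w u * w v * \<bar>u - v\<bar>) = (\<Sum>u\<in>A. w u * (\<Sum>v\<in>A. w v * \<bar>u - v\<bar>))"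
      by (simp add: sum_distrib_left mult.assoc)
    also have "\<dots> = (\<Sum>i\<in>I. f i * (\<Sum>j\<in>I. f j * \<bar>x i - x j\<bar>))"
      by (simp add: grp[of "\<lambda>v. \<bar>_ - v\<bar>"] grp[of "\<lambda>u. \<Sum>j\<in>I. f j * \<bar>u - x j\<bar>"])
    finally show ?thesis by (simp add: sum_distrib_left mult.assoc)
  qed
  \<comment> \<open>Any bound above \<open>A\<close> serves, because the right-hand side of
    \<open>abs_kernel_step\<close> carries the total weight, here zero, as a factor.\<close>
  have "\<forall>u\<in>A. u < Max A + 1"
    by (meson Max_ge fA le_less_trans less_add_one)
  then obtain b where b: "\<forall>u\<in>A. u < b" by blast
  note st = abs_kernel_step[OF fA b, of w, unfolded sumw dbl]
  show "(\<Sum>i\<in>I. \<Sum>j\<in>I. f i * f j * \<bar>x i - x j\<bar>) \<le> 0" using st by simp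
  show "(\<Sum>i\<in>{i\<in>I. x i = y}. f i) = 0"
    if "(\<Sum>i\<in>I. \<Sum>j\<in>I. f i * f j * \<bar>x i - x j\<bar>) = 0"
  proof (cases "y \<in> A")
    case True
    then show ?thesis using st that by (simp add: w_def)
  next
    case False
    then have "{i\<in>I. x i = y} = {}" by (auto simp: A_def)
    then show ?thesis by (simp only: sum.empty)
  qed
qed

lemma sin_abs_diff_eq_cot:
  fixes a b :: real
  assumes "0 < a" "a < pi" "0 < b" "b < pi"
  shows "sin \<bar>a - b\<bar> = sin a * sin b * \<bar>cot a - cot b\<bar>"
proof -
  have *: "sin \<bar>a - b\<bar> = sin a * sin b * \<bar>cot a - cot b\<bar>"
    if ab: "0 < a" "a \<le> b" "b < pi" for a b :: real
  proof -
    have s: "sin a > 0" "sin b > 0" using ab by (auto intro: sin_gt_zero)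
    have e: "sin (b - a) = sin a * sin b * (cot a - cot b)"
      using s by (simp add: sin_diff cot_def field_simps)
    have "sin (b - a) \<ge> 0" using ab by (intro sin_ge_zero) auto
    then have "cot a - cot b \<ge> 0" using e s by (metis mult_pos_pos zero_le_mult_iff not_le)
    then show ?thesis using ab e by simp
  qed
  show ?thesis
  proof (cases "a \<le> b")
    case True then show ?thesis using *[of a b] assms by simp
  next
    case False
    then have "sin \<bar>b - a\<bar> = sin b * sin a * \<bar>cot b - cot a\<bar>" using *[of b a] assms by simp
    then show ?thesis by (simp add: abs_minus_commute mult_ac)
  qed
qed

text \<open>The cotangent substitution fails at the directions \<open>0\<close> and
  \<open>pi\<close>. They drop out of the form: paired with the other sides they give a multiple of
  the total height, which is zero, and paired with each other they give a zero sine. Hence the case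
  of equality says nothing about them.\<close>

lemma half_turn_form:
  fixes psi lam :: "'a \<Rightarrow> real"
  assumes fin: "finite I" and rng: "\<And>i. i \<in> I \<Longrightarrow> 0 \<le> psi i \<and> psi i \<le> pi"
    and zero: "(\<Sum>i\<in>I. lam i * sin (psi i)) = 0"
  shows "(\<Sum>i\<in>I. \<Sum>j\<in>I. lam i * lam j * sin \<bar>psi i - psi j\<bar>) \<le> 0"
    and "(\<Sum>i\<in>I. \<Sum>j\<in>I. lam i * lam j * sin \<bar>psi i - psi j\<bar>) = 0 \<Longrightarrow> 0 < t \<Longrightarrow> t < pi \<Longrightarrow>
      (\<Sum>i\<in>{i\<in>I. psi i = t}. lam i) = 0"
proof -
  define J where "J = {i\<in>I. 0 < psi i \<and> psi i < pi}"
  define K where "K = {i\<in>I. psi i = 0 \<or> psi i = pi}"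
  have IJK: "I = J \<union> K" "J \<inter> K = {}" "finite J" "finite K"
    using rng fin by (force simp: J_def K_def)+
  have zJ: "(\<Sum>i\<in>J. lam i * sin (psi i)) = 0"
  proof -
    have "(\<Sum>i\<in>K. lam i * sin (psi i)) = 0" by (rule sum.neutral) (auto simp: K_def)
    then show ?thesis using zero sum.union_disjoint[OF IJK(3,4,2), of "\<lambda>i. lam i * sin (psi i)"]
      unfolding IJK(1) by simp
  qed
  define q where "q i j = lam i * lam j * sin \<bar>psi i - psi j\<bar>" for i j
  have qKJ: "(\<Sum>j\<in>J. q i j) = 0" if "i \<in> K" for i
  proof -
    have "(\<Sum>j\<in>J. q i j) = (\<Sum>j\<in>J. lam i * (lam j * sin (psi j)))"
      by (rule sum.cong) (use that in \<open>auto simp: K_def J_def q_def\<close>)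
    then show ?thesis using zJ by (simp add: sum_distrib_left[symmetric])
  qed
  have qJK: "(\<Sum>i\<in>J. q i j) = 0" if "j \<in> K" for j
    using qKJ[OF that] by (simp add: q_def abs_minus_commute mult_ac)
  have qKK: "q i j = 0" if "i \<in> K" "j \<in> K" for i j
    using that by (auto simp: K_def q_def)
  have Q: "(\<Sum>i\<in>I. \<Sum>j\<in>I. q i j) = (\<Sum>i\<in>J. \<Sum>j\<in>J. q i j)"
  proof -
    have "(\<Sum>i\<in>J. \<Sum>j\<in>K. q i j) = 0" by (subst sum.swap) (simp add: qJK)
    then show ?thesis
      using IJK(2-4) unfolding IJK(1) by (simp add: sum.union_disjoint sum.distrib qKJ qKK)
  qed
  have J2: "(\<Sum>i\<in>J. \<Sum>j\<in>J. q i j) = (\<Sum>i\<in>J. \<Sum>j\<in>J.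
      (lam i * sin (psi i)) * (lam j * sin (psi j)) * \<bar>cot (psi i) - cot (psi j)\<bar>)"
    by (intro sum.cong refl) (simp add: J_def q_def sin_abs_diff_eq_cot)
  note ker = abs_kernel_neg[OF IJK(3) zJ, of "\<lambda>i. cot (psi i)", folded J2, folded Q, unfolded q_def]
  show "(\<Sum>i\<in>I. \<Sum>j\<in>I. lam i * lam j * sin \<bar>psi i - psi j\<bar>) \<le> 0" by (rule ker(1))
  show "(\<Sum>i\<in>{i\<in>I. psi i = t}. lam i) = 0"
    if "(\<Sum>i\<in>I. \<Sum>j\<in>I. lam i * lam j * sin \<bar>psi i - psi j\<bar>) = 0" "0 < t" "t < pi"
  proof -
    have st: "sin t > 0" using that by (auto intro: sin_gt_zero)
    have "{i\<in>J. cot (psi i) = cot t} = {i\<in>I. psi i = t}"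
    proof -
      have "psi i = t" if "i \<in> J" "cot (psi i) = cot t" for i
      proof -
        have "sin \<bar>psi i - t\<bar> = 0"
          using sin_abs_diff_eq_cot[of "psi i" t] that \<open>0 < t\<close> \<open>t < pi\<close> by (simp add: J_def)
        moreover have "\<bar>psi i - t\<bar> < pi" using that \<open>0 < t\<close> \<open>t < pi\<close> by (auto simp: J_def)
        ultimately show ?thesis using sin_gt_zero[of "\<bar>psi i - t\<bar>"] by force
      qed
      then show ?thesis using that by (auto simp: J_def)
    qed
    then have "(\<Sum>i\<in>{i\<in>I. psi i = t}. lam i * sin (psi i)) = 0"
      using ker(2)[OF that(1), of "cot t"] by simp
    moreover have "(\<Sum>i\<in>{i\<in>I. psi i = t}. lam i * sin (psi i)) = (\<Sum>i\<in>{i\<in>I. psi i = t}. lam i) * sin t"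
      by (simp add: sum_distrib_right)
    ultimately show ?thesis using st by simp
  qed
qed

lemma full_turn_form:
  fixes psi lam :: "'a \<Rightarrow> real"
  assumes fin: "finite I" and rng: "\<And>i. i \<in> I \<Longrightarrow> 0 \<le> psi i \<and> psi i \<le> 2 * pi"
    and sin0: "(\<Sum>i\<in>I. lam i * sin (psi i)) = 0"
    and upper: "(\<Sum>i\<in>{i\<in>I. psi i \<le> pi}. lam i * sin (psi i)) = 0"
  shows "(\<Sum>i\<in>I. \<Sum>j\<in>I. lam i * lam j * sin \<bar>psi i - psi j\<bar>) \<le> 0"
    and "(\<Sum>i\<in>I. \<Sum>j\<in>I. lam i * lam j * sin \<bar>psi i - psi j\<bar>) = 0 \<Longrightarrow> 0 < t \<Longrightarrow> t < 2 * pi \<Longrightarrow> t \<noteq> pi \<Longrightarrow>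
      (\<Sum>i\<in>{i\<in>I. psi i = t}. lam i) = 0"
proof -
  define U where "U = {i\<in>I. psi i \<le> pi}"
  define V where "V = {i\<in>I. psi i > pi}"
  have UV: "I = U \<union> V" "U \<inter> V = {}" "finite U" "finite V"
    using fin by (auto simp: U_def V_def)
  have zU: "(\<Sum>i\<in>U. lam i * sin (psi i)) = 0" using upper by (simp add: U_def)
  have zV: "(\<Sum>i\<in>V. lam i * sin (psi i)) = 0"
    using sin0 zU UV(2-4) unfolding UV(1) by (simp add: sum.union_disjoint)
  define q where "q i j = lam i * lam j * sin \<bar>psi i - psi j\<bar>" for i j
  \<comment> \<open>Every direction in \<open>V\<close> exceeds every direction in \<open>U\<close>,
    so the absolute value can be opened, and the addition theorem turns the mixed part into products
    that each contain a vanishing height.\<close>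
  have UVq: "(\<Sum>i\<in>U. \<Sum>j\<in>V. q i j) = 0"
  proof -
    have "(\<Sum>i\<in>U. \<Sum>j\<in>V. q i j) = (\<Sum>i\<in>U. \<Sum>j\<in>V. (lam i * cos (psi i)) * (lam j * sin (psi j))
         - (lam i * sin (psi i)) * (lam j * cos (psi j)))"
      by (intro sum.cong refl) (simp add: U_def V_def q_def sin_diff algebra_simps)
    also have "\<dots> = 0"
      by (simp add: sum_subtractf sum_negf sum_distrib_left[symmetric] sum_distrib_right[symmetric] zU zV)
    finally show ?thesis .
  qed
  have VUq: "(\<Sum>i\<in>V. \<Sum>j\<in>U. q i j) = 0"
    using UVq by (subst sum.swap) (simp add: q_def abs_minus_commute mult_ac)
  have Q: "(\<Sum>i\<in>I. \<Sum>j\<in>I. q i j) = (\<Sum>i\<in>U. \<Sum>j\<in>U. q i j) + (\<Sum>i\<in>V. \<Sum>j\<in>V. q i j)"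
    using UV(2-4) UVq VUq unfolding UV(1) by (simp add: sum.union_disjoint sum.distrib)
  have rU: "0 \<le> psi i \<and> psi i \<le> pi" if "i \<in> U" for i using that rng by (auto simp: U_def)
  have rV: "0 \<le> psi i - pi \<and> psi i - pi \<le> pi" if "i \<in> V" for i
    using that rng by (force simp: V_def)
  have zV': "(\<Sum>i\<in>V. lam i * sin (psi i - pi)) = 0"
    using zV by (simp add: sin_diff sum_negf)
  note hU = half_turn_form[OF UV(3) rU zU]
  note hV = half_turn_form[OF UV(4) rV zV', simplified]
  have nU: "(\<Sum>i\<in>U. \<Sum>j\<in>U. q i j) \<le> 0" and nV: "(\<Sum>i\<in>V. \<Sum>j\<in>V. q i j) \<le> 0"
    using hU(1) hV(1) by (auto simp: q_def)
  show "(\<Sum>i\<in>I. \<Sum>j\<in>I. lam i * lam j * sin \<bar>psi i - psi j\<bar>) \<le> 0"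
    using Q nU nV by (simp add: q_def)
  show "(\<Sum>i\<in>{i\<in>I. psi i = t}. lam i) = 0"
    if *: "(\<Sum>i\<in>I. \<Sum>j\<in>I. lam i * lam j * sin \<bar>psi i - psi j\<bar>) = 0" and t: "0 < t" "t < 2 * pi" "t \<noteq> pi"
  proof -
    have e: "(\<Sum>i\<in>U. \<Sum>j\<in>U. q i j) = 0" "(\<Sum>i\<in>V. \<Sum>j\<in>V. q i j) = 0"
      using * Q nU nV unfolding q_def by linarith+
    show ?thesis
    proof (cases "t < pi")
      case True
      then have "{i\<in>I. psi i = t} = {i\<in>U. psi i = t}" by (auto simp: U_def)
      then show ?thesis using hU(2)[of t] e True t by (simp add: q_def)
    next
      case False
      then have "{i\<in>I. psi i = t} = {i\<in>V. psi i - pi = t - pi}" using t by (auto simp: V_def)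
      then show ?thesis using hV(2)[of "t - pi"] e False t by (simp add: q_def)
    qed
  qed
qed

lemma sum_group_weights:
  fixes f :: "'a \<Rightarrow> real" and h :: "'b \<Rightarrow> real"
  assumes "finite I" "finite Y" and zero: "\<And>y. y \<notin> Y \<Longrightarrow> (\<Sum>i\<in>{i\<in>I. x i = y}. f i) = 0"
  shows "(\<Sum>i\<in>I. f i * h (x i)) = (\<Sum>y\<in>Y. (\<Sum>i\<in>{i\<in>I. x i = y}. f i) * h y)"
proof -
  have fin: "finite (x ` I \<union> Y)" using assms by simp
  have "(\<Sum>i\<in>I. f i * h (x i)) = (\<Sum>y\<in>x ` I \<union> Y. \<Sum>i\<in>{i\<in>I. x i = y}. f i * h (x i))"
    by (rule sum.group[symmetric]) (use assms fin in auto)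
  also have "\<dots> = (\<Sum>y\<in>x ` I \<union> Y. (\<Sum>i\<in>{i\<in>I. x i = y}. f i) * h y)"
    by (simp add: sum_distrib_right)
  also have "\<dots> = (\<Sum>y\<in>Y. (\<Sum>i\<in>{i\<in>I. x i = y}. f i) * h y)"
    by (rule sum.mono_neutral_right) (use fin zero in auto)
  finally show ?thesis .
qed

section \<open>The cross product of plane vectors as a signed area\<close>

definition cross :: "complex \<Rightarrow> complex \<Rightarrow> real" where
  "cross a b = Im (cnj a * b)"

lemma cross_simps [simp]:
  "cross a 0 = 0" "cross 0 b = 0" "cross a a = 0"
  by (simp_all add: cross_def)

lemma cross_add: "cross (a + b) c = cross a c + cross b c" "cross c (a + b) = cross c a + cross c b"
  and cross_diff: "cross (a - b) c = cross a c - cross b c" "cross c (a - b) = cross c a - cross c b"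
  and cross_minus: "cross (- a) c = - cross a c" "cross c (- a) = - cross c a"
  and cross_scale: "cross (of_real r * a) c = r * cross a c" "cross c (of_real r * a) = r * cross c a"
    "cross (r *\<^sub>R a) c = r * cross a c" "cross c (r *\<^sub>R a) = r * cross c a"
  and cross_commute: "cross a b = - cross b a"
  by (simp_all add: cross_def algebra_simps)

lemma cross_sum: "cross a (\<Sum>i\<in>I. f i) = (\<Sum>i\<in>I. cross a (f i))" "cross (\<Sum>i\<in>I. f i) a = (\<Sum>i\<in>I. cross (f i) a)"
  by (simp_all add: cross_def sum_distrib_left sum_distrib_right)

lemma cross_mult_unit: "norm u = 1 \<Longrightarrow> cross (u * a) (u * b) = cross a b"
proof -
  assume u: "norm u = 1"
  have "cnj (u * a) * (u * b) = (u * cnj u) * (cnj a * b)" by (simp add: mult_ac)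
  also have "u * cnj u = 1" using u by (simp add: complex_norm_square[symmetric])
  finally have "cnj (u * a) * (u * b) = cnj a * b" by simp
  then show ?thesis unfolding cross_def by (rule arg_cong)
qed

lemma cross_cis: "cross (cis a) (cis b) = sin (b - a)"
  by (simp add: cross_def sin_diff mult.commute)

section \<open>Lhuilier's inequality\<close>

text \<open>\<open>psi k\<close> is the direction of side \<open>k\<close> relative to side 0,
  lifted to the reals so that one full turn can be seen. Its increment is the exterior angle: zero
  at a straight angle, and below \<open>pi\<close> because interior angles are positive.\<close>

locale turning =
  fixes n :: nat and psi :: "nat \<Rightarrow> real"
  assumes n_pos: "0 < n" and psi_0: "psi 0 = 0" and psi_n: "psi n = 2 * pi"
    and psi_step: "k < n \<Longrightarrow> psi k \<le> psi (Suc k)" "k < n \<Longrightarrow> psi (Suc k) < psi k + pi"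
begin

lemma psi_mono: "i \<le> j \<Longrightarrow> j \<le> n \<Longrightarrow> psi i \<le> psi j"
proof (induction j rule: dec_induct)
  case (step j)
  then show ?case using psi_step(1)[of j] by auto
qed auto

lemma psi_range: "i \<le> n \<Longrightarrow> 0 \<le> psi i \<and> psi i \<le> 2 * pi"
  using psi_mono[of 0 i] psi_mono[of i n] psi_0 psi_n by auto

text \<open>The turn makes \<open>total_tan\<close> positive, and the strictly climbing side after
  it makes the width of \<open>T\<close> positive. It comes before index \<open>n\<close>, because a
  single step is too short to reach \<open>2 * pi\<close>.\<close>

lemma exists_first_turn: "\<exists>k. Suc k < n \<and> psi k = 0 \<and> 0 < psi (Suc k) \<and> psi (Suc k) < pi"
proof -
  define j where "j = (LEAST j. j \<le> n \<and> 0 < psi j)"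
  have "n \<le> n \<and> 0 < psi n" using psi_n by simp
  then have j: "j \<le> n" "0 < psi j" and least: "\<And>i. i < j \<Longrightarrow> i \<le> n \<Longrightarrow> \<not> 0 < psi i"
    unfolding j_def using LeastI[of "\<lambda>j. j \<le> n \<and> 0 < psi j" n] not_less_Least by blast+
  obtain k where k: "j = Suc k" using j psi_0 by (cases j) auto
  have "psi k = 0" using least[of k] k j psi_range[of k] by auto
  moreover have "psi (Suc k) < pi" using psi_step(2)[of k] j k calculation by auto
  moreover have "Suc k \<noteq> n" using calculation psi_n by auto
  ultimately show ?thesis using j k by (intro exI[of _ k]) auto
qed

text \<open>The distance from corner \<open>Suc k\<close> to the two neighbouring points of contact
  with the unit circle.\<close>

definition half_tan :: "nat \<Rightarrow> real" where
  "half_tan k = tan ((psi (Suc k) - psi k) / 2)"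

definition prev_half_tan :: "nat \<Rightarrow> real" where
  "prev_half_tan k = half_tan (if k = 0 then n - 1 else k - 1)"

definition tangent_length :: "nat \<Rightarrow> real" where
  "tangent_length k = prev_half_tan k + half_tan k"

text \<open>\<open>- \<i> * cis (psi k)\<close> is the point where side \<open>k\<close> touches the
  unit circle about 0, and the vertex lies \<open>prev_half_tan k\<close> before it. Since
  \<open>prev_half_tan n = prev_half_tan 0\<close>, the vertices close up.\<close>

definition tangent_vertex :: "nat \<Rightarrow> complex" where
  "tangent_vertex k = (- \<i> - of_real (prev_half_tan k)) * cis (psi k)"

definition total_tan :: real where
  "total_tan = (\<Sum>k<n. half_tan k)"

lemma half_tan_nonneg: "k < n \<Longrightarrow> 0 \<le> half_tan k"
  unfolding half_tan_def using psi_step[of k]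
  by (cases "psi (Suc k) = psi k") (auto intro!: less_imp_le[OF tan_gt_zero])

lemma prev_half_tan_nonneg: "k \<le> n \<Longrightarrow> 0 \<le> prev_half_tan k"
  unfolding prev_half_tan_def using n_pos by (auto intro!: half_tan_nonneg)

lemma tangent_length_nonneg: "k < n \<Longrightarrow> 0 \<le> tangent_length k"
  unfolding tangent_length_def using half_tan_nonneg prev_half_tan_nonneg[of k] by fastforce

lemma half_tan_pos: "k < n \<Longrightarrow> psi k < psi (Suc k) \<Longrightarrow> 0 < half_tan k"
  unfolding half_tan_def using psi_step[of k] by (intro tan_gt_zero) auto

lemma total_tan_pos: "0 < total_tan"
proof -
  obtain k where k: "Suc k < n" "psi k = 0" "0 < psi (Suc k)" using exists_first_turn by blast
  show ?thesis unfolding total_tan_def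
    by (rule sum_pos2[of _ k]) (use k half_tan_nonneg half_tan_pos[of k] in auto)
qed

lemma sum_tangent_length: "(\<Sum>k<n. tangent_length k) = 2 * total_tan"
proof -
  have "(\<Sum>k<n. prev_half_tan k) = total_tan"
    unfolding total_tan_def prev_half_tan_def
    by (rule sum.reindex_bij_witness[of _ "\<lambda>k. if k = n - 1 then 0 else Suc k"
          "\<lambda>k. if k = 0 then n - 1 else k - 1"]) (use n_pos in auto)
  then show ?thesis by (simp add: tangent_length_def sum.distrib total_tan_def)
qed

text \<open>A corner is as far past one point of contact as it is short of the next. The left side
  is the corner in the frame of the outgoing side, rotated by the turn \<open>b\<close>; the right
  side is the same corner in the frame of the incoming side.\<close>

lemma tan_half_rotation:
  assumes "cos (b / 2) \<noteq> 0"
  shows "(- \<i> - of_real (tan (b / 2))) * cis b = - \<i> + of_real (tan (b / 2))"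
proof -
  define s c where "s = sin (b / 2)" and "c = cos (b / 2)"
  define T where "T = tan (b / 2)"
  have s: "s = T * c" using assms by (simp add: T_def s_def c_def tan_def)
  have "sin b = 2 * T * c\<^sup>2" "cos b = 2 * c\<^sup>2 - 1" "T\<^sup>2 * c\<^sup>2 = 1 - c\<^sup>2"
    using sin_double[of "b/2"] cos_double_cos[of "b/2"] sin_squared_eq[of "b/2"] s
    by (simp_all add: s_def[symmetric] c_def[symmetric] power2_eq_square mult_ac)
  moreover from this have "sin b = T * (1 + cos b)" by simp
  moreover have "T * sin b = T\<^sup>2 * c\<^sup>2 * 2" using calculation(1) by (simp add: power2_eq_square)
  ultimately have "T * sin b + cos b = 1" "sin b - T * cos b = T"
    by (linarith, (simp add: right_diff_distrib))
  then show ?thesis unfolding T_def[symmetric] by (simp add: complex_eq_iff algebra_simps)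
qed

lemma tangent_vertex_Suc:
  assumes "k < n"
  shows "tangent_vertex (Suc k) = (- \<i> + of_real (half_tan k)) * cis (psi k)"
proof -
  define b where "b = psi (Suc k) - psi k"
  have "0 < cos (b / 2)" using psi_step[OF assms] by (intro cos_gt_zero_pi) (auto simp: b_def)
  then have "(- \<i> - of_real (tan (b / 2))) * cis b = - \<i> + of_real (tan (b / 2))"
    by (intro tan_half_rotation) simp
  moreover have "cis (psi (Suc k)) = cis b * cis (psi k)" by (simp add: b_def cis_mult)
  ultimately show ?thesis
    by (simp add: tangent_vertex_def prev_half_tan_def half_tan_def b_def mult.assoc[symmetric])
qed

lemma tangent_vertex_step:
  "k < n \<Longrightarrow> tangent_vertex (Suc k) - tangent_vertex k = of_real (tangent_length k) * cis (psi k)"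
  by (simp add: tangent_vertex_Suc) (simp add: tangent_vertex_def tangent_length_def algebra_simps)

lemma tangent_vertex_n: "tangent_vertex n = tangent_vertex 0"
  using n_pos by (simp add: tangent_vertex_def prev_half_tan_def psi_0 psi_n)

lemma cross_tangent_vertex: "cross (cis (psi k)) (tangent_vertex k) = - 1"
proof -
  have "cnj (cis (psi k)) * tangent_vertex k = (- \<i> - of_real (prev_half_tan k)) * (cis (psi k) * cnj (cis (psi k)))"
    by (simp add: tangent_vertex_def mult_ac)
  also have "\<dots> = - \<i> - of_real (prev_half_tan k)" by (simp add: cis_cnj cis_mult)
  finally show ?thesis by (simp add: cross_def)
qed

lemma sum_tangent: "i \<le> n \<Longrightarrow> (\<Sum>k<i. of_real (tangent_length k) * cis (psi k)) = tangent_vertex i - tangent_vertex 0"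
  by (induction i) (simp_all add: tangent_vertex_step[symmetric])

definition form :: "(nat \<Rightarrow> real) \<Rightarrow> (nat \<Rightarrow> real) \<Rightarrow> real" where
  "form l m = (\<Sum>i<n. \<Sum>j<n. l i * m j * sin \<bar>psi i - psi j\<bar>)"

definition closes :: "(nat \<Rightarrow> real) \<Rightarrow> bool" where
  "closes l \<longleftrightarrow> (\<Sum>i<n. of_real (l i) * cis (psi i)) = 0"

lemma closes_tangent_length: "closes tangent_length"
  by (simp add: closes_def sum_tangent tangent_vertex_n)

text \<open>Closing makes the sum of \<open>m j * sin (psi j - psi i)\<close> vanish. Subtracting it
  cancels the terms with \<open>j >= i\<close> and doubles those with \<open>j < i\<close>, so the
  row becomes a cross product with the point where side \<open>i\<close> starts.\<close>

lemma closes_row: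
  assumes "closes m" "i < n"
  shows "(\<Sum>j<n. m j * sin \<bar>psi i - psi j\<bar>) = 2 * cross (\<Sum>j<i. of_real (m j) * cis (psi j)) (cis (psi i))"
proof -
  have "0 = cross (cis (psi i)) (\<Sum>j<n. of_real (m j) * cis (psi j))"
    using assms by (simp add: closes_def)
  also have "\<dots> = (\<Sum>j<n. m j * sin (psi j - psi i))"
    by (simp add: cross_sum cross_scale cross_cis)
  finally have z: "(\<Sum>j<n. m j * sin (psi j - psi i)) = 0" by simp
  have "(\<Sum>j<n. m j * sin \<bar>psi i - psi j\<bar>) = (\<Sum>j<n. m j * sin \<bar>psi i - psi j\<bar> - m j * sin (psi j - psi i))"
    by (simp add: sum_subtractf z)
  also have "\<dots> = (\<Sum>j<i. m j * sin \<bar>psi i - psi j\<bar> - m j * sin (psi j - psi i))"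
  proof (rule sum.mono_neutral_right)
    show "\<forall>j\<in>{..<n} - {..<i}. m j * sin \<bar>psi i - psi j\<bar> - m j * sin (psi j - psi i) = 0"
      using psi_mono[of i] by auto
  qed (use assms in auto)
  also have "\<dots> = (\<Sum>j<i. 2 * (m j * sin (psi i - psi j)))"
  proof (rule sum.cong)
    fix j assume "j \<in> {..<i}"
    then have "psi j \<le> psi i" using psi_mono[of j i] assms by auto
    moreover have "sin (psi j - psi i) = - sin (psi i - psi j)" by (metis minus_diff_eq sin_minus)
    ultimately show "m j * sin \<bar>psi i - psi j\<bar> - m j * sin (psi j - psi i) = 2 * (m j * sin (psi i - psi j))"
      by simp
  qed auto
  also have "\<dots> = 2 * cross (\<Sum>j<i. of_real (m j) * cis (psi j)) (cis (psi i))"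
    by (simp add: cross_sum cross_scale cross_cis sum_distrib_left)
  finally show ?thesis .
qed

lemma form_row: "form l m = (\<Sum>i<n. l i * (\<Sum>j<n. m j * sin \<bar>psi i - psi j\<bar>))"
  by (simp add: form_def sum_distrib_left mult.assoc)

lemma form_closes:
  assumes "closes l"
  shows "form l l = 2 * (\<Sum>i<n. cross (\<Sum>j<i. of_real (l j) * cis (psi j)) (of_real (l i) * cis (psi i)))"
  unfolding form_row sum_distrib_left[of 2]
  by (rule sum.cong) (simp_all add: closes_row[OF assms] cross_scale)

text \<open>All sides of \<open>T\<close> are at distance 1 from the centre, so the rows of the form
  against \<open>tangent_length\<close> are constant up to a term linear in the direction of the
  side, and that term disappears because \<open>l\<close> closes.\<close>

lemma form_tangent_length:
  assumes "closes l"
  shows "form l tangent_length = 2 * (\<Sum>i<n. l i)"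
proof -
  have "form l tangent_length = (\<Sum>i<n. l i * (2 * (1 - cross (tangent_vertex 0) (cis (psi i)))))"
    unfolding form_row
    by (rule sum.cong) (auto simp: closes_row[OF closes_tangent_length] sum_tangent cross_diff
        cross_tangent_vertex cross_commute[of "tangent_vertex _" "cis _"])
  also have "\<dots> = 2 * (\<Sum>i<n. l i) - 2 * cross (tangent_vertex 0) (\<Sum>i<n. of_real (l i) * cis (psi i))"
    by (simp add: cross_sum cross_scale sum_subtractf sum_distrib_left right_diff_distrib mult.left_commute mult.commute[of _ 2])
  finally show ?thesis using assms by (simp add: closes_def)
qed

lemma form_commute: "form l m = form m l"
  unfolding form_def by (subst sum.swap) (simp add: abs_minus_commute mult_ac)

lemma form_diff:
  "form (\<lambda>i. l i - r * t i) (\<lambda>i. l i - r * t i) = form l l - 2 * r * form l t + r\<^sup>2 * form t t"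
proof -
  have "form (\<lambda>i. l i - r * t i) (\<lambda>i. l i - r * t i) = form l l - r * form l t - r * form t l + r\<^sup>2 * form t t"
    unfolding form_def sum_distrib_left sum_subtractf[symmetric] sum.distrib[symmetric]
    by (intro sum.cong refl) (simp add: algebra_simps power2_eq_square)
  then show ?thesis using form_commute[of t l] by simp
qed

text \<open>For a closed chain with nonnegative lengths the sum over \<open>U\<close> is the height
  climbed by the ascending sides, that is, the width in the imaginary direction. It is positive for
  \<open>T\<close>, so \<open>r\<close> can be taken as a quotient of widths.\<close>

lemma same_width:
  obtains r where "(\<Sum>i\<in>{i\<in>{..<n}. psi i \<le> pi}. (l i - r * tangent_length i) * sin (psi i)) = 0"
proof -
  define U where "U = {i\<in>{..<n}. psi i \<le> pi}"
  obtain k where k: "Suc k < n" "psi k = 0" "0 < psi (Suc k)" "psi (Suc k) < pi" using exists_first_turn by blast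
  define D where "D = (\<Sum>i\<in>U. tangent_length i * sin (psi i))"
  have "0 < D" unfolding D_def
  proof (rule sum_pos2[of _ "Suc k"])
    show "0 < tangent_length (Suc k) * sin (psi (Suc k))"
      using k half_tan_pos[of k] half_tan_nonneg[of "Suc k"]
      by (auto simp: tangent_length_def prev_half_tan_def intro!: mult_pos_pos sin_gt_zero)
    show "0 \<le> tangent_length i * sin (psi i)" if "i \<in> U" for i
      using that psi_range[of i] by (auto simp: U_def intro!: mult_nonneg_nonneg tangent_length_nonneg sin_ge_zero)
  qed (use k in \<open>auto simp: U_def\<close>)
  then have "(\<Sum>i\<in>U. l i * sin (psi i)) / D * D = (\<Sum>i\<in>U. l i * sin (psi i))" by simp
  then have "(\<Sum>i\<in>U. (l i - (\<Sum>i\<in>U. l i * sin (psi i)) / D * tangent_length i) * sin (psi i)) = 0"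
    unfolding left_diff_distrib sum_subtractf mult.assoc sum_distrib_left[symmetric] D_def[symmetric]
    by simp
  then show ?thesis using that unfolding U_def by blast
qed

theorem lhuilier:
  assumes cl: "closes l"
  shows "form l l * total_tan \<le> (\<Sum>i<n. l i)\<^sup>2"
    and "form l l * total_tan = (\<Sum>i<n. l i)\<^sup>2 \<Longrightarrow>
      \<exists>c. \<forall>i<n. cross (cis (psi i)) (c - (\<Sum>j<i. of_real (l j) * cis (psi j))) = (\<Sum>i<n. l i) / (2 * total_tan)"
proof -
  define L where "L = (\<Sum>i<n. l i)"
  obtain r where r: "(\<Sum>i\<in>{i\<in>{..<n}. psi i \<le> pi}. (l i - r * tangent_length i) * sin (psi i)) = 0"
    by (rule same_width)
  define m where "m i = l i - r * tangent_length i" for i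
  have sums: "(\<Sum>i<n. of_real (m i) * cis (psi i)) = 0"
    using cl closes_tangent_length unfolding closes_def m_def
    by (simp add: left_diff_distrib sum_subtractf mult.assoc sum_distrib_left[symmetric])
  have Im0: "(\<Sum>i<n. m i * sin (psi i)) = 0" and Re0: "(\<Sum>i<n. m i * cos (psi i)) = 0"
    using arg_cong[OF sums, of Im] arg_cong[OF sums, of Re] by (simp_all add: mult.commute)
  have rng: "0 \<le> psi i \<and> psi i \<le> 2 * pi" if "i \<in> {..<n}" for i using that psi_range by auto
  note ft = full_turn_form[OF finite_lessThan rng Im0, folded form_def, unfolded m_def, OF _ r,
      folded m_def]
  have fm: "form m m = form l l - 4 * r * L + 4 * r\<^sup>2 * total_tan"
    using form_diff[of l r tangent_length] form_tangent_length[OF cl]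
      form_tangent_length[OF closes_tangent_length] sum_tangent_length
    by (simp add: m_def[abs_def] L_def)
  have le: "form m m \<le> 0" using ft(1) by simp
  \<comment> \<open>The defect in the inequality is a square plus
    \<open>- form m m * total_tan\<close>, both nonnegative. Equality makes both vanish, which fixes
    \<open>r\<close> and puts the form into its own case of equality.\<close>
  have eq: "L\<^sup>2 - form l l * total_tan = (L - 2 * r * total_tan)\<^sup>2 - form m m * total_tan"
    unfolding fm by (simp add: power2_eq_square algebra_simps)
  have nn: "form m m * total_tan \<le> 0" using le total_tan_pos by (simp add: mult_le_0_iff)
  show "form l l * total_tan \<le> (\<Sum>i<n. l i)\<^sup>2"
    using eq nn zero_le_power2[of "L - 2 * r * total_tan"] unfolding L_def by linarith
  show "\<exists>c. \<forall>i<n. cross (cis (psi i)) (c - (\<Sum>j<i. of_real (l j) * cis (psi j))) = (\<Sum>i<n. l i) / (2 * total_tan)"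
    if "form l l * total_tan = (\<Sum>i<n. l i)\<^sup>2"
  proof -
    have "(L - 2 * r * total_tan)\<^sup>2 = 0" "form m m * total_tan = 0"
      using that eq nn zero_le_power2[of "L - 2 * r * total_tan"] unfolding L_def by linarith+
    then have Lr: "L = 2 * r * total_tan" and f0: "form m m = 0" using total_tan_pos by auto
    have rL: "r = L / (2 * total_tan)" using Lr total_tan_pos by simp
    \<comment> \<open>Vanishing of the form leaves only the directions along the real axis open.
      Direction 0 occurs twice, as \<open>0\<close> for the first sides and as \<open>2 * pi\<close>
      for the last ones.\<close>
    define W where "W t = (\<Sum>i\<in>{i\<in>{..<n}. psi i = t}. m i)" for t
    have W0: "W t = 0" if "t \<notin> {0, pi, 2 * pi}" for t
    proof (cases "0 < t \<and> t < 2 * pi")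
      case True
      then show ?thesis using ft(2)[of t] f0 that by (simp add: W_def)
    next
      case False
      then have *: "{i\<in>{..<n}. psi i = t} = {}" using that rng by force
      show ?thesis unfolding W_def * by simp
    qed
    have grp: "(\<Sum>i<n. m i * h (psi i)) = W 0 * h 0 + W pi * h pi + W (2 * pi) * h (2 * pi)" for h
      using sum_group_weights[of "{..<n}" "{0, pi, 2 * pi}" m psi h] W0 by (simp add: W_def)
    \<comment> \<open>The perimeters agree and the real parts cancel, so \<open>W pi = 0\<close> and
      \<open>W 0 = - W (2 * pi)\<close>. The value \<open>W 0\<close> need not vanish: vertex 0 may
      lie inside a geometric side, and \<open>W 0\<close> is then an offset along it.\<close>
    have "(\<Sum>i<n. m i) = L - r * (2 * total_tan)"
      unfolding m_def sum_subtractf sum_distrib_left[symmetric] sum_tangent_length L_def ..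
    then have "W 0 + W pi + W (2 * pi) = 0" using grp[of "\<lambda>_. 1"] Lr by simp
    moreover have "W 0 - W pi + W (2 * pi) = 0" using grp[of cos] Re0 by simp
    ultimately have Wpi: "W pi = 0" by simp
    have part: "cross (cis (psi i)) (\<Sum>j<i. of_real (m j) * cis (psi j)) = cross (cis (psi i)) (of_real (W 0))"
      if i: "i < n" for i
    proof -
      \<comment> \<open>A side in the direction \<open>psi i\<close> contributes no cross product
        with it, so cutting off by direction instead of index loses nothing and the sum can be
        extended to all sides.\<close>
      define h where "h t = (if t < psi i then sin (t - psi i) else 0)" for t
      have "cross (cis (psi i)) (\<Sum>j<i. of_real (m j) * cis (psi j)) = (\<Sum>j<i. m j * sin (psi j - psi i))"
        by (simp add: cross_sum cross_scale cross_cis)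
      also have "\<dots> = (\<Sum>j<i. m j * h (psi j))"
      proof (rule sum.cong)
        fix j assume "j \<in> {..<i}"
        then have "psi j \<le> psi i" using psi_mono[of j i] i by simp
        then show "m j * sin (psi j - psi i) = m j * h (psi j)"
          by (cases "psi j = psi i") (auto simp: h_def)
      qed simp
      also have "\<dots> = (\<Sum>j<n. m j * h (psi j))"
        using psi_mono[of i] i
        by (intro sum.mono_neutral_left) (auto simp: h_def not_less[symmetric] dest: leD)
      also have "\<dots> = W 0 * h 0 + W (2 * pi) * h (2 * pi)" using grp[of h] Wpi by simp
      also have "\<dots> = W 0 * sin (- psi i)" using rng[of i] i by (auto simp: h_def)
      also have "\<dots> = cross (cis (psi i)) (of_real (W 0))" by (simp add: cross_def)
      finally show ?thesis .
    qed
    \<comment> \<open>The centre of \<open>r T\<close>, seen from its first vertex, is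
      \<open>- r * tangent_vertex 0\<close>; the term \<open>W 0\<close> adds the offset along the
      first side.\<close>
    have "cross (cis (psi i)) (of_real (W 0) - of_real r * tangent_vertex 0 - (\<Sum>j<i. of_real (l j) * cis (psi j))) = r"
      if i: "i < n" for i
    proof -
      have "(\<Sum>j<i. of_real (m j) * cis (psi j)) =
          (\<Sum>j<i. of_real (l j) * cis (psi j)) - of_real r * (tangent_vertex i - tangent_vertex 0)"
        using sum_tangent[of i] i unfolding m_def
        by (simp add: left_diff_distrib sum_subtractf mult.assoc sum_distrib_left[symmetric])
      then have "(\<Sum>j<i. of_real (l j) * cis (psi j)) =
          (\<Sum>j<i. of_real (m j) * cis (psi j)) + of_real r * (tangent_vertex i - tangent_vertex 0)"
        by simp
      then show ?thesis using part[OF i] cross_tangent_vertex[of i]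
        by (simp only: cross_diff cross_add cross_scale) (simp add: algebra_simps)
    qed
    then show ?thesis using rL unfolding L_def by blast
  qed
qed

end

section \<open>Paths along polygons\<close>

lemma pathstart_polygonal_path: "ws \<noteq> [] \<Longrightarrow> pathstart (polygonal_path ws) = hd ws"
  by (induction ws rule: polygonal_path.induct) auto

lemma pathfinish_polygonal_path: "ws \<noteq> [] \<Longrightarrow> pathfinish (polygonal_path ws) = last ws"
  by (induction ws rule: polygonal_path.induct) auto

lemma valid_path_polygonal_path: "valid_path (polygonal_path ws)"
  by (induction ws rule: polygonal_path.induct)
    (simp_all only: polygonal_path.simps valid_path_linepath, simp add: pathstart_polygonal_path)

lemma path_image_polygonal_path:
  "2 \<le> length ws \<Longrightarrow>
    path_image (polygonal_path ws) = (\<Union>i<length ws - 1. closed_segment (ws ! i) (ws ! Suc i))"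
proof (induction ws rule: polygonal_path.induct)
  case (4 a b c vs)
  have "{..<length (a # b # c # vs) - 1} = insert 0 (Suc ` {..<length (b # c # vs) - 1})"
    by (simp add: lessThan_Suc_eq_insert_0)
  then show ?case using 4 by (simp add: path_image_join pathstart_polygonal_path)
qed auto

text \<open>A segment seen from a point on its left has a winding number with positive real part.
  The path may be open, which lets the induction split off one side at a time.\<close>

lemma winding_number_polygonal_path_pos:
  "2 \<le> length ws \<Longrightarrow> (\<And>i. i < length ws - 1 \<Longrightarrow> 0 < cross (ws ! Suc i - ws ! i) (z - ws ! i)) \<Longrightarrow>
    z \<notin> path_image (polygonal_path ws) \<and> 0 < Re (winding_number (polygonal_path ws) z)"
proof (induction ws rule: polygonal_path.induct)
  case (3 a b)
  then have "0 < cross (b - a) (z - a)" by force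
  then have *: "0 < Im ((b - a) * cnj (b - z))" by (simp add: cross_def algebra_simps)
  have "z \<notin> path_image (linepath a b)"
    using * by (simp add: closed_segment_def) (force simp: algebra_simps)
  with * show ?case using winding_number_linepath_pos_lt by simp
next
  case (4 a b c vs)
  have "0 < cross (b - a) (z - a)" using "4.prems"(2)[of 0] by simp
  then have *: "0 < Im ((b - a) * cnj (b - z))" by (simp add: cross_def algebra_simps)
  have za: "z \<notin> path_image (linepath a b)"
    using * by (simp add: closed_segment_def) (force simp: algebra_simps)
  have IH: "z \<notin> path_image (polygonal_path (b # c # vs))" "0 < Re (winding_number (polygonal_path (b # c # vs)) z)"
    using "4.IH" "4.prems"(2)[of "Suc _"] by auto
  have "winding_number (polygonal_path (a # b # c # vs)) z =
      winding_number (linepath a b) z + winding_number (polygonal_path (b # c # vs)) z"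
    using za IH(1) by (simp add: winding_number_join valid_path_imp_path[OF valid_path_polygonal_path]
        pathstart_polygonal_path)
  then show ?case
    using za IH winding_number_linepath_pos_lt[OF *]
    by (auto simp: path_image_join pathstart_polygonal_path)
qed auto

lemma arc_polygonal_path_segments:
  "arc (polygonal_path ws) \<Longrightarrow> i < j \<Longrightarrow> Suc j < length ws \<Longrightarrow>
    closed_segment (ws ! i) (ws ! Suc i) \<inter> closed_segment (ws ! j) (ws ! Suc j) \<subseteq> set ws"
proof (induction ws arbitrary: i j rule: polygonal_path.induct)
  case (4 a b c vs)
  have a: "arc (polygonal_path (b # c # vs))"
    and sub: "closed_segment a b \<inter> path_image (polygonal_path (b # c # vs)) \<subseteq> {b}"
    using "4.prems"(1) by (auto simp: arc_join_eq pathstart_polygonal_path)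
  obtain j' where j: "j = Suc j'" using "4.prems" by (cases j) auto
  show ?case
  proof (cases i)
    case 0
    have "closed_segment ((a # b # c # vs) ! j) ((a # b # c # vs) ! Suc j) \<subseteq> path_image (polygonal_path (b # c # vs))"
      using "4.prems" j by (subst path_image_polygonal_path) auto
    with 0 sub show ?thesis by auto
  next
    case (Suc i')
    then show ?thesis using "4.IH"[OF a, of i' j'] "4.prems" j by auto
  qed
qed auto

lemma linear_image_linepath:
  assumes "linear f"
  shows "linepath (f a) (f b) = f \<circ> linepath a b"
  by (simp add: linepath_def fun_eq_iff linear_add[OF assms] linear_scale[OF assms])

lemma polygonal_path_linear_image:
  assumes "linear f"
  shows "ws \<noteq> [] \<Longrightarrow> polygonal_path (map f ws) = f \<circ> polygonal_path ws"
proof (induction ws rule: polygonal_path.induct)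
  case (2 a) then show ?case by (simp add: linear_image_linepath[OF assms])
next
  case (3 a b) then show ?case by (simp add: linear_image_linepath[OF assms])
next
  case (4 a b c vs)
  then have IH: "polygonal_path (map f (b # c # vs)) = f \<circ> polygonal_path (b # c # vs)" by blast
  have "polygonal_path (map f (a # b # c # vs)) = linepath (f a) (f b) +++ polygonal_path (map f (b # c # vs))"
    by simp
  then show ?case unfolding IH linear_image_linepath[OF assms] by (simp add: path_compose_join)
qed auto

definition vertex :: "complex list \<Rightarrow> nat \<Rightarrow> complex" where
  "vertex vs k = vs ! (k mod length vs)"

lemma nth_closed_list: "vs \<noteq> [] \<Longrightarrow> i \<le> length vs \<Longrightarrow> (vs @ [hd vs]) ! i = vertex vs i"
  by (cases "i = length vs") (auto simp: nth_append vertex_def hd_conv_nth)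

lemma next_vertex_eq: "next_vertex vs i = vertex vs (Suc i)"
  by (simp add: next_vertex_def vertex_def)

lemma boundary_path_ends: "vs \<noteq> [] \<Longrightarrow> pathstart (boundary_path vs) = hd vs" "vs \<noteq> [] \<Longrightarrow> pathfinish (boundary_path vs) = hd vs"
  by (simp_all add: boundary_path_def pathstart_polygonal_path pathfinish_polygonal_path)

lemma path_image_boundary_path:
  assumes "vs \<noteq> []"
  shows "path_image (boundary_path vs) = (\<Union>i<length vs. closed_segment (vertex vs i) (vertex vs (Suc i)))"
  unfolding boundary_path_def using assms
  by (subst path_image_polygonal_path) (auto simp: Suc_le_eq nth_closed_list)

lemma boundary_path_Cons:
  assumes "2 \<le> length vs"
  shows "boundary_path vs = linepath (hd vs) (hd (tl vs)) +++ polygonal_path (tl vs @ [hd vs])"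
proof -
  obtain a b ws where "vs = a # b # ws" using assms by (metis Suc_le_length_iff numeral_2_eq_2)
  then show ?thesis by (cases ws) (auto simp: boundary_path_def)
qed

text \<open>A simple closed path is its first side joined to an arc, which reduces the claim to
  arcs. Landing in \<open>set vs\<close> is precise enough for the area, where the overlap of two
  triangles only has to lie on finitely many segments from the centre to vertices.\<close>

lemma simple_boundary_path_segments:
  assumes "simple_path (boundary_path vs)" "2 \<le> length vs" "i < j" "j < length vs"
  shows "closed_segment (vertex vs i) (vertex vs (Suc i)) \<inter> closed_segment (vertex vs j) (vertex vs (Suc j)) \<subseteq> set vs"
proof -
  obtain a b ws where vs: "vs = a # b # ws" using assms by (metis Suc_le_length_iff numeral_2_eq_2)
  define us where "us = b # ws @ [a]"
  have nth: "vertex vs k = (a # us) ! k" if "k \<le> length vs" for k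
    using nth_closed_list[of vs k] that vs by (simp add: us_def)
  have "simple_path (linepath a b +++ polygonal_path us)"
    using assms(1) boundary_path_Cons[OF assms(2)] by (simp add: vs us_def)
  then have arc: "arc (polygonal_path us)" and sub: "closed_segment a b \<inter> path_image (polygonal_path us) \<subseteq> {a, b}"
    by (auto elim!: simple_path_joinE simp: pathstart_polygonal_path us_def)
  have set: "set us = set vs" by (auto simp: us_def vs)
  obtain j' where j: "j = Suc j'" using assms by (cases j) auto
  have len: "length us = length vs" by (simp add: us_def vs)
  show ?thesis
  proof (cases i)
    case 0
    have "closed_segment (us ! j') (us ! Suc j') \<subseteq> path_image (polygonal_path us)"
      using assms j len by (subst path_image_polygonal_path) (auto intro!: bexI[of _ j'])
    moreover have "vertex vs i = a" "vertex vs (Suc i) = b" using 0 by (auto simp: vertex_def vs)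
    moreover have "vertex vs j = us ! j'" "vertex vs (Suc j) = us ! Suc j'"
      using assms j by (auto simp: nth)
    ultimately show ?thesis using sub by (auto simp: vs)
  next
    case (Suc i')
    then show ?thesis using arc_polygonal_path_segments[OF arc, of i' j'] assms j set len
      by (auto simp: nth)
  qed
qed

section \<open>Area of a triangle in the complex plane\<close>

lemma lborel_complex_eq:
  "(lborel :: complex measure) = distr lborel borel (\<lambda>x::real^2. Complex (x $ 1) (x $ 2))"
proof (rule lborel_eqI)
  define g where "g = (\<lambda>x::real^2. Complex (x $ 1) (x $ 2))"
  have gm: "g \<in> borel_measurable borel"
    unfolding g_def Complex_eq by (intro borel_measurable_continuous_onI continuous_intros)
  fix l u :: complex
  assume le: "\<And>b. b \<in> Basis \<Longrightarrow> l \<bullet> b \<le> u \<bullet> b"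
  have l1: "Re l \<le> Re u" "Im l \<le> Im u" using le[of 1] le[of \<i>] by (auto simp: Basis_complex_def)
  have vim: "g -` box l u = box (vector [Re l, Im l]) (vector [Re u, Im u])"
    by (auto simp: g_def in_box_complex_iff mem_box_cart forall_2)
  have "emeasure (distr lborel borel g) (box l u) = emeasure lborel (g -` box l u)"
    using gm by (subst emeasure_distr) auto
  also have "\<dots> = ennreal (\<Prod>b\<in>Basis. (vector [Re u, Im u] - vector [Re l, Im l] :: real^2) \<bullet> b)"
    unfolding vim
  proof (rule emeasure_lborel_box)
    fix b :: "real^2" assume "b \<in> Basis"
    then obtain i where "b = axis i 1" by (auto simp: Basis_vec_def)
    then show "vector [Re l, Im l] \<bullet> b \<le> vector [Re u, Im u] \<bullet> b"
      using l1 exhaust_2[of i] by (auto simp: inner_axis)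
  qed
  also have "(\<Prod>b\<in>Basis. (vector [Re u, Im u] - vector [Re l, Im l] :: real^2) \<bullet> b) = (Re u - Re l) * (Im u - Im l)"
  proof -
    have B: "(Basis :: (real^2) set) = {axis 1 1, axis 2 1}"
      unfolding Basis_vec_def UNIV_2 by auto
    show ?thesis unfolding B by (simp add: inner_axis axis_eq_axis)
  qed
  also have "\<dots> = (\<Prod>b\<in>Basis. (u - l) \<bullet> b)" by (simp add: Basis_complex_def)
  finally show "emeasure (distr lborel borel (\<lambda>x::real^2. Complex (x $ 1) (x $ 2))) (box l u) = (\<Prod>b\<in>Basis. (u - l) \<bullet> b)"
    by (simp add: g_def)
qed simp

text \<open>\<open>content_triangle\<close> speaks of \<open>real^2\<close>; the identification of
  the two Lebesgue measures, which need only be compared on boxes, carries it over.\<close>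

lemma measure_triangle_complex:
  fixes a b c :: complex
  shows "measure lebesgue (convex hull {a, b, c}) = \<bar>cross (b - a) (c - a)\<bar> / 2"
proof -
  define g where "g = (\<lambda>x::real^2. Complex (x $ 1) (x $ 2))"
  define f where "f = (\<lambda>z. vector [Re z, Im z] :: real^2)"
  have gm: "g \<in> borel_measurable borel"
    unfolding g_def Complex_eq by (intro borel_measurable_continuous_onI continuous_intros)
  have fg: "f (g x) = x" and gf: "g (f z) = z" for x z
    by (simp_all add: f_def g_def vec_eq_iff forall_2)
  have lin: "linear f" by (rule linearI) (simp_all add: f_def vec_eq_iff forall_2)
  define S where "S = convex hull {a, b, c}"
  have S: "S \<in> sets borel" unfolding S_def
    by (intro borel_compact compact_convex_hull finite_imp_compact) simp
  have vim: "g -` S = convex hull {f a, f b, f c}"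
  proof -
    have "g -` S = f ` S" by (auto simp: fg intro: image_eqI[of _ f "g _"]) (simp add: gf)
    then show ?thesis unfolding S_def convex_hull_linear_image[OF lin] by simp
  qed
  have "measure lebesgue S = measure lborel S" using S by simp
  also have "\<dots> = measure lborel (g -` S)"
    unfolding lborel_complex_eq g_def[symmetric] using gm S by (subst measure_distr) auto
  also have "\<dots> = \<bar>cross (b - a) (c - a)\<bar> / 2"
    unfolding vim content_triangle
    by (simp add: f_def cross_def) (simp add: abs_if algebra_simps)
  finally show ?thesis by (simp add: S_def)
qed

section \<open>The region of a polygon with monotonically turning sides\<close>

lemma cross_eq_inner: "cross a b = (\<i> * a) \<bullet> b"
  by (simp add: cross_def inner_complex_def)

lemma cross_le_norm: "\<bar>cross a b\<bar> \<le> norm a * norm b"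
  unfolding cross_eq_inner using Cauchy_Schwarz_ineq2[of "\<i> * a" b] by (simp add: norm_mult)

text \<open>The rotation \<open>u\<close> is the direction of side 0, which keeps the normalisation
  \<open>psi 0 = 0\<close>.\<close>

locale turning_polygon = turning n psi for n psi +
  fixes vs :: "complex list" and u :: complex and len :: "nat \<Rightarrow> real"
  assumes n_ge_3: "3 \<le> n" and length_vs: "length vs = n" and norm_u: "norm u = 1"
    and len_pos: "k < n \<Longrightarrow> 0 < len k"
    and side: "k < n \<Longrightarrow> vertex vs (Suc k) - vertex vs k = of_real (len k) * (u * cis (psi k))"
begin

definition dir :: "nat \<Rightarrow> complex" where "dir k = u * cis (psi k)"

lemma norm_dir: "norm (dir k) = 1"
  by (simp add: dir_def norm_mult norm_u)

lemma dir_nz: "dir k \<noteq> 0"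
  using norm_dir[of k] by auto

lemma cross_dir: "cross (dir k) (u * z) = cross (cis (psi k)) z"
  unfolding dir_def by (rule cross_mult_unit[OF norm_u])

lemma vs_ne: "vs \<noteq> []"
  using n_ge_3 length_vs by auto

lemma vertex_n: "vertex vs n = vertex vs 0"
  by (simp add: vertex_def length_vs)

lemma vertex_diff:
  "k \<le> i \<Longrightarrow> i \<le> n \<Longrightarrow> vertex vs i - vertex vs k = u * (\<Sum>j=k..<i. of_real (len j) * cis (psi j))"
proof (induction i rule: dec_induct)
  case (step i)
  have "vertex vs (Suc i) - vertex vs k = (vertex vs (Suc i) - vertex vs i) + (vertex vs i - vertex vs k)"
    by simp
  also have "\<dots> = of_real (len i) * (u * cis (psi i)) + u * (\<Sum>j=k..<i. of_real (len j) * cis (psi j))"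
    using step side[of i] by simp
  finally show ?case using step by (simp add: algebra_simps)
qed auto

lemma closes_len: "closes len"
proof -
  have "u * (\<Sum>j<n. of_real (len j) * cis (psi j)) = 0"
    using vertex_diff[of 0 n] by (simp add: vertex_n atLeast0LessThan)
  then show ?thesis using norm_u by (auto simp: closes_def)
qed

text \<open>\<open>f i\<close> is what side \<open>i\<close> adds to the height above side
  \<open>k\<close>. As the directions make one monotone turn, the height first rises from side
  \<open>k\<close> on and then falls back to zero at vertex \<open>k\<close>. So either every side
  up to vertex \<open>j\<close> rises, or every side from \<open>j\<close> round to \<open>k\<close>
  falls.\<close>

lemma left_of_side:
  assumes "k < n" "j \<le> n"
  shows "0 \<le> cross (dir k) (vertex vs j - vertex vs k)"
proof -
  define f where "f i = len i * sin (psi i - psi k)" for i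
  have tot: "(\<Sum>i=0..<n. f i) = 0"
  proof -
    have "cross (cis (psi k)) (\<Sum>j<n. of_real (len j) * cis (psi j)) = (\<Sum>i=0..<n. f i)"
      by (simp add: cross_sum cross_scale cross_cis f_def atLeast0LessThan)
    then show ?thesis using closes_len by (simp add: closes_def)
  qed
  \<comment> \<open>The second alternative covers the sides at least half a turn before
    \<open>k\<close>; they rise because directions count modulo \<open>2 * pi\<close>.\<close>
  have pos: "0 \<le> f i" if "i < n" "0 \<le> psi i - psi k \<and> psi i - psi k \<le> pi \<or> psi i - psi k \<le> - pi" for i
  proof -
    have "0 \<le> sin (psi i - psi k)"
    proof (cases "0 \<le> psi i - psi k \<and> psi i - psi k \<le> pi")
      case False
      then have "psi i - psi k \<le> - pi" using that by blast
      then have "0 \<le> sin (psi i - psi k + 2 * pi)"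
        using psi_range[of i] psi_range[of k] assms(1) that(1) by (intro sin_ge_zero) auto
      then show ?thesis by simp
    qed (auto intro: sin_ge_zero)
    then show ?thesis using len_pos[OF that(1)] by (simp add: f_def)
  qed
  have neg: "f i \<le> 0" if "i < n" "- pi \<le> psi i - psi k \<and> psi i - psi k \<le> 0 \<or> pi \<le> psi i - psi k" for i
  proof -
    have "0 \<le> sin (psi k - psi i)"
    proof (cases "- pi \<le> psi i - psi k \<and> psi i - psi k \<le> 0")
      case False
      then have "pi \<le> psi i - psi k" using that by blast
      then have "0 \<le> sin (psi k - psi i + 2 * pi)"
        using psi_range[of i] psi_range[of k] assms(1) that(1) by (intro sin_ge_zero) auto
      then show ?thesis by simp
    qed (auto intro: sin_ge_zero)
    moreover have "sin (psi i - psi k) = - sin (psi k - psi i)" by (metis minus_diff_eq sin_minus)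
    ultimately show ?thesis using len_pos[OF that(1)] by (simp add: f_def mult_nonneg_nonpos)
  qed
  have cr: "cross (dir k) (vertex vs b - vertex vs a) = (\<Sum>i=a..<b. f i)" if "a \<le> b" "b \<le> n" for a b
    unfolding vertex_diff[OF that] cross_dir by (simp add: cross_sum cross_scale cross_cis f_def)
  show ?thesis
  proof (cases "k \<le> j")
    case kj: True
    have split: "(\<Sum>i=0..<k. f i) + (\<Sum>i=k..<j. f i) + (\<Sum>i=j..<n. f i) = 0"
      using tot kj assms by (simp add: sum.atLeastLessThan_concat)
    have "0 \<le> (\<Sum>i=k..<j. f i)"
    proof (cases "\<forall>i\<in>{k..<j}. psi i - psi k \<le> pi")
      case True
      then show ?thesis using psi_mono[of k] assms by (intro sum_nonneg pos) auto
    next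
      case False
      \<comment> \<open>Side \<open>m\<close> is past the half turn, so all sides from
        \<open>j\<close> on descend and, cyclically, so do those before \<open>k\<close>. The
        closing sum then forces the part in between to be nonnegative.\<close>
      then obtain m where m: "k \<le> m" "m < j" "pi < psi m - psi k" by auto
      have "(\<Sum>i=0..<k. f i) \<le> 0"
      proof (intro sum_nonpos neg)
        fix i assume i: "i \<in> {0..<k}"
        then show "i < n" using assms by auto
        have "psi k - pi \<le> 0" using m psi_range[of m] assms by auto
        then show "- pi \<le> psi i - psi k \<and> psi i - psi k \<le> 0 \<or> pi \<le> psi i - psi k"
          using psi_mono[of i k] psi_range[of i] i assms by auto
      qed
      moreover have "(\<Sum>i=j..<n. f i) \<le> 0"
      proof (intro sum_nonpos neg)
        fix i assume i: "i \<in> {j..<n}"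
        then show "i < n" by auto
        show "- pi \<le> psi i - psi k \<and> psi i - psi k \<le> 0 \<or> pi \<le> psi i - psi k"
          using psi_mono[of m i] m i by auto
      qed
      ultimately show ?thesis using split by linarith
    qed
    then show ?thesis using cr[OF kj] assms by simp
  next
    case False
    then have jk: "j \<le> k" by simp
    have split: "(\<Sum>i=0..<j. f i) + (\<Sum>i=j..<k. f i) + (\<Sum>i=k..<n. f i) = 0"
      using tot jk assms by (simp add: sum.atLeastLessThan_concat)
    have "(\<Sum>i=j..<k. f i) \<le> 0"
    proof (cases "\<forall>i\<in>{j..<k}. - pi \<le> psi i - psi k")
      case True
      then show ?thesis using psi_mono[of _ k] assms by (intro sum_nonpos neg) auto
    next
      case False
      then obtain m where m: "j \<le> m" "m < k" "psi m - psi k < - pi" by auto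
      have "0 \<le> (\<Sum>i=0..<j. f i)"
      proof (intro sum_nonneg pos)
        fix i assume i: "i \<in> {0..<j}"
        then show "i < n" using assms by auto
        show "0 \<le> psi i - psi k \<and> psi i - psi k \<le> pi \<or> psi i - psi k \<le> - pi"
          using psi_mono[of i m] m i assms by auto
      qed
      moreover have "0 \<le> (\<Sum>i=k..<n. f i)"
      proof (intro sum_nonneg pos)
        fix i assume i: "i \<in> {k..<n}"
        then show "i < n" by auto
        have "pi \<le> psi k" using m psi_range[of m] assms by auto
        then show "0 \<le> psi i - psi k \<and> psi i - psi k \<le> pi \<or> psi i - psi k \<le> - pi"
          using psi_mono[of k i] psi_range[of i] i by auto
      qed
      ultimately show ?thesis using split by linarith
    qed
    then show ?thesis using cr[OF jk] assms cross_minus(2)[of "dir k" "vertex vs k - vertex vs j"] by simp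
  qed
qed

definition wide :: "complex set" where
  "wide = {x. \<forall>k<n. 0 \<le> cross (dir k) (x - vertex vs k)}"

definition core :: "complex set" where
  "core = {x. \<forall>k<n. 0 < cross (dir k) (x - vertex vs k)}"

lemma wide_Inter: "wide = (\<Inter>k<n. {x. (\<i> * dir k) \<bullet> x \<ge> (\<i> * dir k) \<bullet> vertex vs k})"
  by (auto simp: wide_def cross_eq_inner inner_diff_right)

lemma core_Inter: "core = (\<Inter>k<n. {x. (\<i> * dir k) \<bullet> x > (\<i> * dir k) \<bullet> vertex vs k})"
  by (auto simp: core_def cross_eq_inner inner_diff_right)

lemma closed_wide: "closed wide"
  unfolding wide_Inter by (intro closed_INT ballI closed_halfspace_ge)

lemma convex_wide: "convex wide"
  unfolding wide_Inter by (intro convex_INT convex_halfspace_ge)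

lemma open_core: "open core"
  unfolding core_Inter by (intro open_INT ballI open_halfspace_gt) auto

lemma interior_wide: "interior wide = core"
proof
  show "core \<subseteq> interior wide"
    by (rule interior_maximal[OF _ open_core]) (auto simp: core_def wide_def less_imp_le)
  have "interior wide \<subseteq> {x. (\<i> * dir k) \<bullet> x > (\<i> * dir k) \<bullet> vertex vs k}" if "k < n" for k
  proof -
    have "interior wide \<subseteq> interior {x. (\<i> * dir k) \<bullet> x \<ge> (\<i> * dir k) \<bullet> vertex vs k}"
      using that by (intro interior_mono) (auto simp: wide_Inter)
    then show ?thesis using dir_nz by simp
  qed
  then show "interior wide \<subseteq> core" by (auto simp: core_Inter)
qed

lemma vertex_in_wide: "j \<le> n \<Longrightarrow> vertex vs j \<in> wide"
  using left_of_side by (auto simp: wide_def)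

lemma path_image_subset_wide: "path_image (boundary_path vs) \<subseteq> wide"
proof -
  have "closed_segment (vertex vs i) (vertex vs (Suc i)) \<subseteq> wide" if "i < n" for i
    using that vertex_in_wide[of i] vertex_in_wide[of "Suc i"] convex_wide
    by (intro closed_segment_subset) auto
  then show ?thesis using path_image_boundary_path[OF vs_ne] by (auto simp: length_vs)
qed

lemma winding_number_core:
  assumes "z \<in> core"
  shows "z \<notin> path_image (boundary_path vs)" "0 < Re (winding_number (boundary_path vs) z)"
proof -
  have "z \<notin> path_image (boundary_path vs) \<and> 0 < Re (winding_number (boundary_path vs) z)"
    unfolding boundary_path_def
  proof (rule winding_number_polygonal_path_pos)
    fix i assume "i < length (vs @ [hd vs]) - 1"
    then have i: "i < n" by (simp add: length_vs)
    have "(vs @ [hd vs]) ! i = vertex vs i" "(vs @ [hd vs]) ! Suc i = vertex vs (Suc i)"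
      using i vs_ne length_vs by (auto intro!: nth_closed_list)
    then show "0 < cross ((vs @ [hd vs]) ! Suc i - (vs @ [hd vs]) ! i) (z - (vs @ [hd vs]) ! i)"
      using side[OF i] assms i len_pos[OF i] by (simp add: core_def cross_scale flip: dir_def)
  qed (use n_ge_3 length_vs in auto)
  then show "z \<notin> path_image (boundary_path vs)" "0 < Re (winding_number (boundary_path vs) z)" by auto
qed

lemma path_boundary: "path (boundary_path vs)" "pathfinish (boundary_path vs) = pathstart (boundary_path vs)"
  using valid_path_imp_path[OF valid_path_polygonal_path] vs_ne
  by (simp_all add: boundary_path_def boundary_path_ends[unfolded boundary_path_def])

lemma core_subset_inside: "core \<subseteq> inside (path_image (boundary_path vs))"
proof
  fix z assume z: "z \<in> core"
  show "z \<in> inside (path_image (boundary_path vs))"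
  proof (rule ccontr)
    assume "z \<notin> inside (path_image (boundary_path vs))"
    then have "z \<in> outside (path_image (boundary_path vs))"
      using winding_number_core(1)[OF z] inside_Un_outside[of "path_image (boundary_path vs)"] by blast
    then have "winding_number (boundary_path vs) z = 0"
      using path_boundary by (intro winding_number_zero_in_outside) auto
    then show False using winding_number_core(2)[OF z] by simp
  qed
qed

text \<open>Positive winding numbers put \<open>core\<close> inside. Conversely, the complement of
  the convex set \<open>wide\<close> lies outside the path, and the inside is open, hence contained
  in the interior of \<open>wide\<close>.\<close>

lemma inside_eq_core: "inside (path_image (boundary_path vs)) = core"
proof
  have "inside (path_image (boundary_path vs)) \<subseteq> wide"
  proof
    fix z assume z: "z \<in> inside (path_image (boundary_path vs))"
    show "z \<in> wide"
    proof (rule ccontr)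
      assume "z \<notin> wide"
      then have "z \<in> outside wide" using convex_wide convex_in_outside by blast
      then have "z \<in> outside (path_image (boundary_path vs))"
        using outside_mono[OF path_image_subset_wide] by blast
      then show False using z inside_Int_outside by blast
    qed
  qed
  moreover have "open (inside (path_image (boundary_path vs)))"
    by (intro open_inside closed_path_image path_boundary)
  ultimately show "inside (path_image (boundary_path vs)) \<subseteq> core"
    using interior_maximal interior_wide by blast
qed (rule core_subset_inside)

lemma dist_side: "k < n \<Longrightarrow> dist (vertex vs k) (vertex vs (Suc k)) = len k"
  using side[of k] len_pos[of k] norm_dir[of k]
  by (simp add: dist_norm norm_minus_commute[of "vertex vs k"] norm_mult flip: dir_def)

lemma perimeter_eq: "perimeter vs = (\<Sum>k<n. len k)"
  unfolding perimeter_def length_vs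
  by (rule sum.cong) (auto simp: next_vertex_eq dist_side[symmetric] vertex_def length_vs)

lemma cross_dir_vertex:
  assumes "k \<le> n"
  shows "cross (dir k) (c - vertex vs k) =
    cross (cis (psi k)) ((c - vertex vs 0) / u - (\<Sum>j<k. of_real (len j) * cis (psi j)))"
proof -
  have u: "u \<noteq> 0" using norm_u by auto
  have "c - vertex vs k = u * ((c - vertex vs 0) / u) - (vertex vs k - vertex vs 0)" using u by simp
  also have "\<dots> = u * ((c - vertex vs 0) / u - (\<Sum>j<k. of_real (len j) * cis (psi j)))"
    using vertex_diff[of 0 k] assms by (simp add: atLeast0LessThan right_diff_distrib)
  finally show ?thesis by (simp only: cross_dir)
qed

text \<open>The summands are twice the signed areas of the triangles with apex \<open>c\<close>. The
  point \<open>c\<close> enters linearly and disappears because the chain closes.\<close>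

lemma sum_len_cross_dir: "(\<Sum>k<n. len k * cross (dir k) (c - vertex vs k)) = form len len / 2"
proof -
  have "(\<Sum>k<n. len k * cross (dir k) (c - vertex vs k)) =
      (\<Sum>k<n. cross (of_real (len k) * cis (psi k)) ((c - vertex vs 0) / u)
        + cross (\<Sum>j<k. of_real (len j) * cis (psi j)) (of_real (len k) * cis (psi k)))"
  proof (rule sum.cong)
    fix k assume "k \<in> {..<n}"
    then show "len k * cross (dir k) (c - vertex vs k) =
        cross (of_real (len k) * cis (psi k)) ((c - vertex vs 0) / u)
        + cross (\<Sum>j<k. of_real (len j) * cis (psi j)) (of_real (len k) * cis (psi k))"
      using cross_commute[of "cis (psi k)" "\<Sum>j<k. of_real (len j) * cis (psi j)"]
      unfolding cross_dir_vertex[OF less_imp_le[OF \<open>k \<in> {..<n}\<close>[unfolded lessThan_iff]]]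
      by (simp add: cross_diff cross_scale distrib_left)
  qed simp
  also have "\<dots> = form len len / 2"
    using closes_len by (simp add: sum.distrib cross_sum(2)[symmetric] closes_def form_closes[OF closes_len])
  finally show ?thesis .
qed

text \<open>The form of \<open>len\<close> against \<open>tangent_length\<close> is evaluated twice.
  As all sides have distance \<open>r\<close> from \<open>c\<close>, the rows of \<open>len\<close>
  are constant up to a term that closing removes; the rows of \<open>tangent_length\<close> give
  twice the perimeter.\<close>

lemma equidistant_perimeter:
  assumes "\<And>k. k < n \<Longrightarrow> cross (dir k) (c - vertex vs k) = r"
  shows "(\<Sum>k<n. len k) = 2 * r * total_tan" "form len len = 2 * r * (\<Sum>k<n. len k)"
proof -
  show "form len len = 2 * r * (\<Sum>k<n. len k)"
    using sum_len_cross_dir[of c] assms by (simp add: sum_distrib_left mult_ac)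
  define w where "w = (c - vertex vs 0) / u"
  have r: "2 * cross (\<Sum>j<k. of_real (len j) * cis (psi j)) (cis (psi k)) =
      2 * r - 2 * cross (cis (psi k)) w" if "k < n" for k
    using cross_dir_vertex[of k c] assms[OF that] that
      cross_commute[of "cis (psi k)" "\<Sum>j<k. of_real (len j) * cis (psi j)"]
    by (simp add: w_def cross_diff)
  have "form tangent_length len = (\<Sum>k<n. tangent_length k * (2 * r - 2 * cross (cis (psi k)) w))"
    unfolding form_row by (rule sum.cong) (simp_all add: closes_row[OF closes_len] r)
  also have "\<dots> = 2 * r * (\<Sum>k<n. tangent_length k)
      - 2 * cross (\<Sum>k<n. of_real (tangent_length k) * cis (psi k)) w"
    by (simp add: right_diff_distrib sum_subtractf sum_distrib_left cross_sum cross_scale)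
      (simp add: mult_ac)
  also have "\<dots> = 4 * r * total_tan"
    using closes_tangent_length by (simp add: sum_tangent_length closes_def)
  finally show "(\<Sum>k<n. len k) = 2 * r * total_tan"
    using form_tangent_length[OF closes_len] form_commute[of len] by simp
qed

lemma side_hull_eq_range:
  assumes "k < n"
  shows "affine hull {vs ! k, next_vertex vs k} = range (\<lambda>s. vertex vs k + s *\<^sub>R dir k)"
proof -
  have k: "vs ! k = vertex vs k" "next_vertex vs k = vertex vs (Suc k)"
    using assms by (auto simp: vertex_def length_vs next_vertex_eq)
  have "range (\<lambda>s. vertex vs k + s *\<^sub>R (vertex vs (Suc k) - vertex vs k)) = range (\<lambda>s. vertex vs k + s *\<^sub>R dir k)"
  proof (intro equalityI subsetI; elim rangeE)
    fix x s assume "x = vertex vs k + s *\<^sub>R (vertex vs (Suc k) - vertex vs k)"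
    then have "x = vertex vs k + (s * len k) *\<^sub>R dir k"
      using side[OF assms] by (simp add: dir_def scaleR_conv_of_real)
    then show "x \<in> range (\<lambda>s. vertex vs k + s *\<^sub>R dir k)" by blast
  next
    fix x s assume "x = vertex vs k + s *\<^sub>R dir k"
    then have "x = vertex vs k + (s / len k) *\<^sub>R (vertex vs (Suc k) - vertex vs k)"
      using side[OF assms] len_pos[OF assms] by (simp add: dir_def scaleR_conv_of_real)
    then show "x \<in> range (\<lambda>s. vertex vs k + s *\<^sub>R (vertex vs (Suc k) - vertex vs k))" by blast
  qed
  then show ?thesis unfolding k affine_hull_2_alt by simp
qed

lemma foot_of_perpendicular:
  obtains s where "c - (cross (dir k) (c - vertex vs k)) *\<^sub>R (\<i> * dir k) = vertex vs k + s *\<^sub>R dir k"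
proof -
  define z where "z = (c - vertex vs k) * cnj (dir k)"
  have "dir k * cnj (dir k) = 1" using norm_dir[of k] by (simp add: complex_norm_square[symmetric])
  then have "c - vertex vs k = z * dir k" by (simp add: z_def mult_ac)
  also have "z = of_real (Re z) + \<i> * of_real (cross (dir k) (c - vertex vs k))"
    by (simp add: z_def cross_def complex_eq_iff mult.commute)
  finally have "c - (cross (dir k) (c - vertex vs k)) *\<^sub>R (\<i> * dir k) = vertex vs k + Re z *\<^sub>R dir k"
    by (simp add: scaleR_conv_of_real algebra_simps)
  then show ?thesis by (rule that)
qed

lemma dist_line:
  "(dist c (c - h *\<^sub>R (\<i> * dir k) + s *\<^sub>R dir k))\<^sup>2 = h\<^sup>2 + s\<^sup>2"
proof -
  have "c - (c - h *\<^sub>R (\<i> * dir k) + s *\<^sub>R dir k) = Complex (- s) h * dir k"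
    by (simp add: complex_eq_iff algebra_simps)
  then show ?thesis
    unfolding dist_norm by (simp add: norm_mult norm_dir cmod_power2)
qed

end

section \<open>Region, area and inscribed circle of a simple polygon\<close>

locale simple_turning_polygon = turning_polygon +
  assumes simple: "simple_path (boundary_path vs)"
begin

lemma core_ne: "core \<noteq> {}"
  using Jordan_inside_outside[OF simple path_boundary(2)] inside_eq_core by simp

lemma closure_core: "closure core = wide"
  using convex_closure_interior[OF convex_wide] core_ne closed_wide by (simp add: interior_wide)

lemma path_image_eq_frontier: "path_image (boundary_path vs) = frontier wide"
proof -
  have "path_image (boundary_path vs) = frontier core"
    using Jordan_inside_outside[OF simple path_boundary(2)] inside_eq_core by simp
  also have "\<dots> = frontier wide"
    using interior_wide open_core closure_core closed_wide by (simp add: frontier_def interior_open)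
  finally show ?thesis .
qed

lemma region_eq: "polygon_region vs = wide"
proof -
  have "frontier wide = wide - core" using closed_wide by (simp add: frontier_def interior_wide)
  moreover have "core \<subseteq> wide" using interior_subset[of wide] by (simp add: interior_wide)
  ultimately show ?thesis
    unfolding polygon_region_def inside_eq_core unfolding path_image_eq_frontier by auto
qed

lemma bounded_wide: "bounded wide"
proof -
  have "bounded core" unfolding inside_eq_core[symmetric]
    by (intro bounded_inside bounded_path_image path_boundary)
  then show ?thesis using closure_core bounded_closure by metis
qed

definition slice :: "complex \<Rightarrow> nat \<Rightarrow> complex set" where
  "slice c k = convex hull {c, vertex vs k, vertex vs (Suc k)}"

lemma slice_point:
  assumes "x \<in> slice c k"
  obtains y t where "y \<in> closed_segment (vertex vs k) (vertex vs (Suc k))" "0 \<le> t" "t \<le> 1" "x = c + t *\<^sub>R (y - c)"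
proof -
  obtain p q b where *: "0 \<le> p" "0 \<le> q" "p + q = 1" "b \<in> convex hull {vertex vs k, vertex vs (Suc k)}"
    "x = p *\<^sub>R c + q *\<^sub>R b"
    using assms unfolding slice_def by (subst (asm) convex_hull_insert) auto
  have p: "p = 1 - q" using * by simp
  show ?thesis by (rule that[of b q]) (use * in \<open>auto simp: p segment_convex_hull algebra_simps\<close>)
qed

lemma slice_measurable: "slice c k \<in> lmeasurable"
  unfolding slice_def by (intro lmeasurable_compact compact_convex_hull finite_imp_compact) simp

text \<open>The ray from \<open>c\<close> through \<open>x\<close> leaves the bounded set
  \<open>wide\<close> at a frontier point \<open>y\<close>, which lies on some side, and
  \<open>x\<close> lies between \<open>c\<close> and \<open>y\<close>.\<close>

lemma wide_eq_slices:
  assumes c: "c \<in> core"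
  shows "wide = (\<Union>k<n. slice c k)"
proof
  have cw: "c \<in> wide" using c interior_wide interior_subset by blast
  show "(\<Union>k<n. slice c k) \<subseteq> wide"
  proof (clarify)
    fix x k assume "k < n" "x \<in> slice c k"
    moreover have "slice c k \<subseteq> wide" unfolding slice_def
      using cw vertex_in_wide[of k] vertex_in_wide[of "Suc k"] \<open>k < n\<close> convex_wide
      by (intro hull_minimal) auto
    ultimately show "x \<in> wide" by blast
  qed
  show "wide \<subseteq> (\<Union>k<n. slice c k)"
  proof
    fix x assume x: "x \<in> wide"
    show "x \<in> (\<Union>k<n. slice c k)"
    proof (cases "x = c")
      case True
      then have "x \<in> slice c 0" unfolding slice_def by (intro hull_inc) auto
      then show ?thesis using n_pos by blast
    next
      case False
      obtain d where d: "0 < d" "c + d *\<^sub>R (x - c) \<in> frontier wide"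
        "\<And>e. \<lbrakk>0 \<le> e; e < d\<rbrakk> \<Longrightarrow> c + e *\<^sub>R (x - c) \<in> interior wide"
        using ray_to_frontier[OF bounded_wide, of c "x - c"] c False interior_wide by auto
      define y where "y = c + d *\<^sub>R (x - c)"
      have "1 \<le> d"
      proof (rule ccontr)
        assume "\<not> 1 \<le> d"
        have "y \<in> open_segment c x" unfolding y_def in_segment
          using d(1) \<open>\<not> 1 \<le> d\<close> False by (auto intro!: exI[of _ d] simp: algebra_simps)
        moreover have "open_segment c x \<subseteq> interior wide"
          using c x interior_wide closed_wide by (intro in_interior_closure_convex_segment convex_wide) auto
        ultimately show False using d(2) by (auto simp: y_def frontier_def)
      qed
      have "y \<in> path_image (boundary_path vs)" using d(2) path_image_eq_frontier by (simp add: y_def)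
      then obtain k where k: "k < n" "y \<in> closed_segment (vertex vs k) (vertex vs (Suc k))"
        using path_image_boundary_path[OF vs_ne] length_vs by auto
      have "x = (1 - 1 / d) *\<^sub>R c + (1 / d) *\<^sub>R y"
        using d(1) by (simp add: y_def algebra_simps)
      moreover have "y \<in> slice c k"
        using k(2) hull_mono[of "{vertex vs k, vertex vs (Suc k)}" "{c, vertex vs k, vertex vs (Suc k)}" convex]
        by (auto simp: slice_def segment_convex_hull)
      moreover have "c \<in> slice c k" unfolding slice_def by (intro hull_inc) auto
      ultimately have "x \<in> slice c k"
        using convexD_alt[of "slice c k" c y "1 / d"] \<open>1 \<le> d\<close> by (simp add: slice_def)
      then show ?thesis using k by blast
    qed
  qed
qed

text \<open>A ray from the interior point \<open>c\<close> meets the frontier only once, so a common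
  point other than \<open>c\<close> comes from a point shared by the two sides, which is a
  vertex.\<close>

lemma slice_overlap:
  assumes c: "c \<in> core" and ij: "i < j" "j < n"
  shows "slice c i \<inter> slice c j \<subseteq> (\<Union>v\<in>set vs. closed_segment c v) \<union> {c}"
proof
  fix x assume x: "x \<in> slice c i \<inter> slice c j"
  obtain y s where y: "y \<in> closed_segment (vertex vs i) (vertex vs (Suc i))" "0 \<le> s" "s \<le> 1" "x = c + s *\<^sub>R (y - c)"
    using x slice_point[of x c i] by blast
  obtain z t where z: "z \<in> closed_segment (vertex vs j) (vertex vs (Suc j))" "0 \<le> t" "t \<le> 1" "x = c + t *\<^sub>R (z - c)"
    using x slice_point[of x c j] by blast
  have fr: "y \<in> frontier wide" "z \<in> frontier wide"
    using y(1) z(1) path_image_boundary_path[OF vs_ne] length_vs ij path_image_eq_frontier by auto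
  have ci: "c \<in> interior wide" using c interior_wide by simp
  have no: False if "p \<in> frontier wide" "q \<in> frontier wide" "0 < e" "e < 1" "p = c + e *\<^sub>R (q - c)" for p q e
  proof -
    have "c \<noteq> q" using that ci by (auto simp: frontier_def)
    then have "p \<in> open_segment c q"
      unfolding in_segment using that by (auto intro!: exI[of _ e] simp: algebra_simps)
    moreover have "open_segment c q \<subseteq> interior wide"
      using ci that(2) frontier_closed by (intro in_interior_closure_convex_segment convex_wide) (auto simp: frontier_def)
    ultimately show False using that(1) by (auto simp: frontier_def)
  qed
  show "x \<in> (\<Union>v\<in>set vs. closed_segment c v) \<union> {c}"
  proof (cases "x = c")
    case False
    then have st: "0 < s" "0 < t" using y z by (auto simp: less_le)
    have e: "s *\<^sub>R (y - c) = t *\<^sub>R (z - c)" using y(4) z(4) by simp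
    have "y = c + (t / s) *\<^sub>R (z - c)"
    proof -
      have "y - c = (1 / s) *\<^sub>R (s *\<^sub>R (y - c))" using st by simp
      also have "\<dots> = (t / s) *\<^sub>R (z - c)" unfolding e by simp
      finally show ?thesis by (simp add: algebra_simps)
    qed
    moreover have "z = c + (s / t) *\<^sub>R (y - c)"
    proof -
      have "z - c = (1 / t) *\<^sub>R (t *\<^sub>R (z - c))" using st by simp
      also have "\<dots> = (s / t) *\<^sub>R (y - c)" unfolding e[symmetric] by simp
      finally show ?thesis by (simp add: algebra_simps)
    qed
    ultimately have "\<not> t / s < 1" "\<not> s / t < 1"
      using no[OF fr, of "t / s"] no[OF fr(2,1), of "s / t"] st by auto
    then have "s = t" using st by simp
    then have "y = z" using e st by simp
    then have "y \<in> set vs"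
      using simple_boundary_path_segments[OF simple, of i j] ij y(1) z(1) length_vs n_ge_3 by auto
    moreover have "x \<in> closed_segment c y" unfolding in_segment
      using y by (auto intro!: exI[of _ s] simp: algebra_simps)
    ultimately show ?thesis by blast
  qed simp
qed

lemma area_eq: "area vs = form len len / 4"
proof -
  obtain c where c: "c \<in> core" using core_ne by blast
  have neg: "negligible (closed_segment c v)" for v
    by (rule negligible_convex_interior[THEN iffD2]) (simp_all add: interior_closed_segment_ge2)
  have "negligible ((\<Union>v\<in>set vs. closed_segment c v) \<union> {c})"
    using neg by (intro negligible_Un negligible_Union) auto
  then have dis: "negligible (slice c i \<inter> slice c j)" if "i < n" "j < n" "i \<noteq> j" for i j
    using slice_overlap[OF c, of i j] slice_overlap[OF c, of j i] that negligible_subset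
    by (metis inf_commute linorder_neq_iff)
  have "area vs = (\<Sum>k<n. measure lebesgue (slice c k))"
    unfolding area_def region_eq wide_eq_slices[OF c]
    by (rule measure_negligible_finite_Union_image) (auto simp: slice_measurable pairwise_def dis)
  also have "\<dots> = (\<Sum>k<n. len k * cross (dir k) (c - vertex vs k)) / 2"
    unfolding sum_divide_distrib
  proof (rule sum.cong)
    fix k assume "k \<in> {..<n}"
    then have k: "k < n" by simp
    have "cross (vertex vs k - c) (vertex vs (Suc k) - c) = cross (vertex vs k - c) ((vertex vs (Suc k) - vertex vs k) + (vertex vs k - c))"
      by simp
    also have "\<dots> = len k * cross (vertex vs k - c) (dir k)"
      unfolding side[OF k] by (simp only: cross_add cross_scale cross_simps dir_def)
    also have "\<dots> = len k * cross (dir k) (c - vertex vs k)"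
      by (simp add: cross_diff cross_commute[of _ "dir k"])
    finally have "cross (vertex vs k - c) (vertex vs (Suc k) - c) = len k * cross (dir k) (c - vertex vs k)" .
    moreover have "0 < cross (dir k) (c - vertex vs k)" using c k by (simp add: core_def)
    ultimately show "measure lebesgue (slice c k) = len k * cross (dir k) (c - vertex vs k) / 2"
      using len_pos[OF k] by (simp add: slice_def measure_triangle_complex)
  qed simp
  finally show ?thesis unfolding sum_len_cross_dir by simp
qed

text \<open>Reflection in the perpendicular from \<open>c\<close> to the line of a side preserves
  the intersection with the circle, so a unique common point must be the foot of the perpendicular.
  That \<open>c\<close> lies on the left follows from the circle being part of the region.\<close>

lemma circumscribed_iff:
  assumes r: "0 < r"
  shows "circumscribed_about vs c r \<longleftrightarrow> (\<forall>k<n. cross (dir k) (c - vertex vs k) = r)"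
proof
  assume L: "circumscribed_about vs c r"
  have sub: "sphere c r \<subseteq> wide"
    and tang: "\<And>k. k < n \<Longrightarrow> \<exists>!z. z \<in> affine hull {vs ! k, next_vertex vs k} \<inter> sphere c r"
    using L by (auto simp: circumscribed_about_def region_eq length_vs)
  show "\<forall>k<n. cross (dir k) (c - vertex vs k) = r"
  proof (intro allI impI)
    fix k assume k: "k < n"
    define h where "h = cross (dir k) (c - vertex vs k)"
    \<comment> \<open>\<open>c\<close> is the midpoint of two points of the circle, and both lie in
      \<open>wide\<close>.\<close>
    have "h \<ge> 0"
    proof -
      have "c + of_real r \<in> wide" "c - of_real r \<in> wide"
        using sub r by (auto intro!: subsetD[OF sub] simp: dist_norm)
      then have "0 \<le> cross (dir k) (c + of_real r - vertex vs k) + cross (dir k) (c - of_real r - vertex vs k)"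
        using k by (simp add: wide_def)
      also have "\<dots> = 2 * h" by (simp add: h_def cross_add cross_diff)
      finally show ?thesis by simp
    qed
    obtain s0 where s0: "c - h *\<^sub>R (\<i> * dir k) = vertex vs k + s0 *\<^sub>R dir k"
      using foot_of_perpendicular[of c k] unfolding h_def by blast
    obtain z where z: "z \<in> affine hull {vs ! k, next_vertex vs k}" "z \<in> sphere c r"
      and uniq: "\<And>y. y \<in> affine hull {vs ! k, next_vertex vs k} \<Longrightarrow> y \<in> sphere c r \<Longrightarrow> y = z"
      using tang[OF k] by blast
    obtain s where s: "z = vertex vs k + s *\<^sub>R dir k" using z(1) side_hull_eq_range[OF k] by auto
    define e where "e = s - s0"
    have ze: "z = c - h *\<^sub>R (\<i> * dir k) + e *\<^sub>R dir k" unfolding s0 s e_def by (simp add: algebra_simps)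
    define y where "y = c - h *\<^sub>R (\<i> * dir k) + (- e) *\<^sub>R dir k"
    have he: "h\<^sup>2 + e\<^sup>2 = r\<^sup>2" using z(2) dist_line[of c h k e] by (simp add: ze)
    have "(dist c y)\<^sup>2 = r\<^sup>2" unfolding y_def dist_line using he by simp
    then have "y \<in> sphere c r" using r by (simp add: power2_eq_iff_nonneg)
    moreover have "y = vertex vs k + (s0 - e) *\<^sub>R dir k" unfolding y_def s0 by (simp add: algebra_simps)
    then have "y \<in> affine hull {vs ! k, next_vertex vs k}" using side_hull_eq_range[OF k] by auto
    ultimately have "y = z" using uniq by blast
    then have "2 * e = 0" using dir_nz[of k] by (simp add: y_def ze)
    then show "cross (dir k) (c - vertex vs k) = r" using he \<open>h \<ge> 0\<close> r
      by (simp add: h_def power2_eq_iff_nonneg)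
  qed
next
  assume R: "\<forall>k<n. cross (dir k) (c - vertex vs k) = r"
  show "circumscribed_about vs c r" unfolding circumscribed_about_def region_eq length_vs
  proof (intro conjI allI impI)
    show "sphere c r \<subseteq> wide"
    proof
      fix x assume x: "x \<in> sphere c r"
      have "0 \<le> cross (dir k) (x - vertex vs k)" if "k < n" for k
      proof -
        have "cross (dir k) (x - vertex vs k) = cross (dir k) (x - c) + r"
          using R[rule_format, OF that] by (simp add: cross_diff)
        moreover have "\<bar>cross (dir k) (x - c)\<bar> \<le> r"
          using cross_le_norm[of "dir k" "x - c"] x by (simp add: norm_dir dist_norm norm_minus_commute)
        ultimately show ?thesis by linarith
      qed
      then show "x \<in> wide" by (simp add: wide_def)
    qed
    fix k assume k: "k < n"
    have h: "cross (dir k) (c - vertex vs k) = r" using R k by blast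
    obtain s0 where s0: "c - r *\<^sub>R (\<i> * dir k) = vertex vs k + s0 *\<^sub>R dir k"
      using foot_of_perpendicular[of c k] unfolding h by blast
    show "\<exists>!z. z \<in> affine hull {vs ! k, next_vertex vs k} \<inter> sphere c r"
    proof (rule ex1I[of _ "c - r *\<^sub>R (\<i> * dir k)"])
      have "(dist c (c - r *\<^sub>R (\<i> * dir k)))\<^sup>2 = r\<^sup>2" using dist_line[of c r k 0] by simp
      then have "c - r *\<^sub>R (\<i> * dir k) \<in> sphere c r" using r by (simp add: power2_eq_iff_nonneg)
      then show "c - r *\<^sub>R (\<i> * dir k) \<in> affine hull {vs ! k, next_vertex vs k} \<inter> sphere c r"
        using side_hull_eq_range[OF k] s0 by auto
      fix z assume z: "z \<in> affine hull {vs ! k, next_vertex vs k} \<inter> sphere c r"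
      then obtain s where s: "z = vertex vs k + s *\<^sub>R dir k" using side_hull_eq_range[OF k] by auto
      have ze: "z = c - r *\<^sub>R (\<i> * dir k) + (s - s0) *\<^sub>R dir k" unfolding s0 s by (simp add: algebra_simps)
      have "r\<^sup>2 + (s - s0)\<^sup>2 = r\<^sup>2" using z dist_line[of c r k "s - s0"] by (simp add: ze)
      then show "z = c - r *\<^sub>R (\<i> * dir k)" by (simp add: ze)
    qed
  qed
qed

lemma circumscribed_area_perimeter:
  assumes "circumscribed_unit_circle vs"
  shows "area vs = total_tan" "perimeter vs = 2 * total_tan"
proof -
  obtain c where "circumscribed_about vs c 1" using assms by (auto simp: circumscribed_unit_circle_def)
  then have c: "\<And>k. k < n \<Longrightarrow> cross (dir k) (c - vertex vs k) = 1" using circumscribed_iff[of 1 c] by simp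
  show "perimeter vs = 2 * total_tan" using equidistant_perimeter(1)[OF c] perimeter_eq by simp
  show "area vs = total_tan"
    using equidistant_perimeter[OF c] by (simp add: area_eq)
qed

lemma lhuilier_perimeter:
  "4 * area vs * total_tan \<le> (perimeter vs)\<^sup>2"
  using lhuilier(1)[OF closes_len] by (simp add: area_eq perimeter_eq)

lemma lhuilier_equality:
  assumes "area vs = total_tan" "perimeter vs = 2 * total_tan"
  shows "circumscribed_unit_circle vs"
proof -
  have "form len len * total_tan = (\<Sum>i<n. len i)\<^sup>2"
    using assms by (simp add: area_eq perimeter_eq power2_eq_square)
  then obtain c where c: "\<forall>i<n. cross (cis (psi i)) (c - (\<Sum>j<i. of_real (len j) * cis (psi j))) = 1"
    using lhuilier(2)[OF closes_len] assms total_tan_pos by (auto simp: perimeter_eq)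
  have u: "u \<noteq> 0" using norm_u by auto
  have "\<forall>k<n. cross (dir k) (vertex vs 0 + u * c - vertex vs k) = 1"
    using c u by (simp add: cross_dir_vertex)
  then show ?thesis
    unfolding circumscribed_unit_circle_def using circumscribed_iff[of 1 "vertex vs 0 + u * c"] by auto
qed

end

text \<open>The side lengths may differ, since vertices with straight angles can sit elsewhere. The
  half-planes at distance 1 from the centre depend only on \<open>psi\<close> and the rotation, so
  moving centre to centre and turning by \<open>u' / u\<close> matches the regions.\<close>

lemma turning_polygons_congruent:
  assumes "simple_turning_polygon n psi vs u len" "simple_turning_polygon n psi ws u' len'"
    and "circumscribed_unit_circle vs" "circumscribed_unit_circle ws"
  shows "congruent_polygons vs ws"
proof -
  interpret P: simple_turning_polygon n psi vs u len by fact
  interpret Q: simple_turning_polygon n psi ws u' len' by fact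
  obtain c where "circumscribed_about vs c 1" using assms by (auto simp: circumscribed_unit_circle_def)
  then have c: "\<And>k. k < n \<Longrightarrow> cross (P.dir k) (c - vertex vs k) = 1" using P.circumscribed_iff[of 1 c] by simp
  obtain c' where "circumscribed_about ws c' 1" using assms by (auto simp: circumscribed_unit_circle_def)
  then have c': "\<And>k. k < n \<Longrightarrow> cross (Q.dir k) (c' - vertex ws k) = 1" using Q.circumscribed_iff[of 1 c'] by simp
  have u: "u \<noteq> 0" "u' \<noteq> 0" using P.norm_u Q.norm_u by auto
  define f where "f x = c' + (u' / u) * (x - c)" for x
  define g where "g y = c + (u / u') * (y - c')" for y
  have fg: "f (g y) = y" for y using u by (simp add: f_def g_def)
  have iso: "dist (f x) (f y) = dist x y" for x y
  proof -
    have "f x - f y = (u' / u) * (x - y)" unfolding f_def right_diff_distrib by simp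
    then show ?thesis using P.norm_u Q.norm_u by (simp add: dist_norm norm_mult norm_divide)
  qed
  have mem: "f x \<in> Q.wide \<longleftrightarrow> x \<in> P.wide" for x
  proof -
    have "cross (Q.dir k) (f x - vertex ws k) = cross (P.dir k) (x - vertex vs k)" if "k < n" for k
    proof -
      have "cross (Q.dir k) (f x - c') = cross (u' * cis (psi k)) (u' * ((x - c) / u))"
        using u by (simp add: f_def Q.dir_def)
      also have "\<dots> = cross (u * cis (psi k)) (u * ((x - c) / u))"
        by (simp only: cross_mult_unit[OF P.norm_u] cross_mult_unit[OF Q.norm_u])
      also have "\<dots> = cross (P.dir k) (x - c)" using u by (simp add: P.dir_def)
      finally show ?thesis using c[OF that] c'[OF that] by (simp add: cross_diff)
    qed
    then show ?thesis by (simp add: P.wide_def Q.wide_def)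
  qed
  have "f ` P.wide = Q.wide"
  proof
    show "Q.wide \<subseteq> f ` P.wide"
    proof
      fix y assume "y \<in> Q.wide"
      then have "g y \<in> P.wide" using mem[of "g y"] fg[of y] by simp
      then show "y \<in> f ` P.wide" using fg[of y] by (metis imageI)
    qed
  qed (use mem in blast)
  then show ?thesis using iso unfolding congruent_polygons_def P.region_eq Q.region_eq by blast
qed

section \<open>Polygons with given angles\<close>

text \<open>The turn from side \<open>j\<close> to the next one takes place at vertex
  \<open>Suc j\<close>, hence the shifted index; the turn at vertex 0 comes last and completes the
  circle.\<close>

definition direction_angle :: "real list \<Rightarrow> nat \<Rightarrow> real" where
  "direction_angle as k = (\<Sum>j<k. pi - as ! (Suc j mod length as))"

lemma sum_Suc_mod:
  fixes f :: "nat \<Rightarrow> 'a::comm_monoid_add"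
  assumes "0 < n"
  shows "(\<Sum>j<n. f (Suc j mod n)) = (\<Sum>j<n. f j)"
  by (rule sum.reindex_bij_witness[of _ "\<lambda>j. if j = 0 then n - 1 else j - 1" "\<lambda>j. Suc j mod n"])
    (use assms in \<open>auto simp: mod_Suc\<close>)

lemma sum_list_nth_lessThan: "(\<Sum>x\<leftarrow>xs. f x) = (\<Sum>j<length xs. f (xs ! j))"
  by (simp add: sum_list_sum_nth atLeast0LessThan)

lemma admissible_ge_3:
  assumes "admissible_angles n as"
  shows "3 \<le> n"
proof (rule ccontr)
  assume "\<not> 3 \<le> n"
  have len: "length as = n" and pos: "\<And>a. a \<in> set as \<Longrightarrow> 0 < a" and s: "sum_list as = (real n - 2) * pi"
    using assms by (auto simp: admissible_angles_def)
  consider "n = 0" | "n = 1" | "n = 2" using \<open>\<not> 3 \<le> n\<close> by linarith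
  then show False
  proof cases
    case 1 then show False using len s by simp
  next
    case 2
    then obtain a where "as = [a]" using len by (metis One_nat_def length_0_conv length_Suc_conv)
    then show False using s pos[of a] 2 pi_gt_zero by auto
  next
    case 3
    then obtain a b where "as = [a, b]" using len
      by (metis (no_types, opaque_lifting) numeral_2_eq_2 length_0_conv length_Suc_conv)
    then show False using s pos[of a] pos[of b] 3 by auto
  qed
qed

context
  fixes n as
  assumes adm: "admissible_angles n as"
begin

lemma admissible_length: "length as = n"
  using adm by (simp add: admissible_angles_def)

lemma admissible_nth: "k < n \<Longrightarrow> 0 < as ! k \<and> as ! k \<le> pi"
  using adm by (auto simp: admissible_angles_def)

lemma turning_direction_angle: "turning n (direction_angle as)"
proof
  have n: "3 \<le> n" by (rule admissible_ge_3[OF adm])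
  then show "0 < n" by simp
  show "direction_angle as 0 = 0" by (simp add: direction_angle_def)
  have "direction_angle as n = (\<Sum>j<n. pi - as ! j)"
    unfolding direction_angle_def admissible_length using n by (intro sum_Suc_mod) auto
  also have "\<dots> = real n * pi - sum_list as"
    using sum_list_nth_lessThan[of "\<lambda>x. x" as] by (simp add: sum_subtractf admissible_length)
  also have "\<dots> = 2 * pi" using adm by (simp add: admissible_angles_def algebra_simps)
  finally show "direction_angle as n = 2 * pi" .
  fix k assume "k < n"
  then have "0 < as ! (Suc k mod n) \<and> as ! (Suc k mod n) \<le> pi" by (intro admissible_nth) auto
  then show "direction_angle as k \<le> direction_angle as (Suc k)" "direction_angle as (Suc k) < direction_angle as k + pi"
    by (simp_all add: direction_angle_def admissible_length)
qed

lemma total_tan_direction_angle: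
  "turning.total_tan n (direction_angle as) = (\<Sum>a\<leftarrow>as. cot (a / 2))"
proof -
  interpret turning n "direction_angle as" by (rule turning_direction_angle)
  have "total_tan = (\<Sum>k<n. cot (as ! (Suc k mod n) / 2))"
    unfolding total_tan_def
  proof (rule sum.cong)
    fix k assume "k \<in> {..<n}"
    have "half_tan k = tan (pi / 2 - as ! (Suc k mod n) / 2)"
      by (simp add: half_tan_def direction_angle_def admissible_length diff_divide_distrib)
    then show "half_tan k = cot (as ! (Suc k mod n) / 2)"
      by (simp add: tan_def cot_def sin_diff cos_diff)
  qed simp
  also have "\<dots> = (\<Sum>k<n. cot (as ! k / 2))" by (rule sum_Suc_mod[OF n_pos])
  finally show ?thesis by (simp add: sum_list_nth_lessThan admissible_length)
qed

end

lemma vertex_Suc_mod: "vertex vs (Suc (k mod length vs)) = vertex vs (Suc k)"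
  by (simp add: vertex_def mod_Suc_eq)

lemma interior_angle_vertex:
  assumes "k < length vs"
  shows "interior_angle vs (Suc k mod length vs) =
    Arg2pi ((vertex vs k - vertex vs (Suc k)) / (vertex vs (Suc (Suc k)) - vertex vs (Suc k)))"
proof -
  have "prev_vertex vs (Suc k mod length vs) = vertex vs k"
  proof (cases "Suc k = length vs")
    case True
    then have "length vs - 1 = k" by simp
    then show ?thesis using True assms by (auto simp: prev_vertex_def vertex_def)
  qed (use assms in \<open>auto simp: prev_vertex_def vertex_def\<close>)
  moreover have "next_vertex vs (Suc k mod length vs) = vertex vs (Suc (Suc k))"
    unfolding next_vertex_eq by (rule vertex_Suc_mod)
  ultimately show ?thesis by (simp add: interior_angle_def vertex_def)
qed

lemma interior_angle_turn:
  assumes "k < length vs" and pos: "0 < interior_angle vs (Suc k mod length vs)"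
  defines "e \<equiv> \<lambda>k. vertex vs (Suc k) - vertex vs k"
  shows "e k \<noteq> 0" "e (Suc k) \<noteq> 0"
    "e (Suc k) = of_real (norm (e (Suc k)) / norm (e k)) * cis (pi - interior_angle vs (Suc k mod length vs)) * e k"
proof -
  define q where "q = (vertex vs k - vertex vs (Suc k)) / (vertex vs (Suc (Suc k)) - vertex vs (Suc k))"
  define a where "a = interior_angle vs (Suc k mod length vs)"
  have a: "a = Arg2pi q" unfolding a_def q_def by (rule interior_angle_vertex[OF assms(1)])
  \<comment> \<open>Division by zero and \<open>Arg2pi 0\<close> both give 0, so a positive angle
    already rules out sides of length zero.\<close>
  have "q \<noteq> 0" using pos a unfolding a_def by auto
  then show nz: "e k \<noteq> 0" "e (Suc k) \<noteq> 0" by (auto simp: q_def e_def)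
  have q: "q = - e k / e (Suc k)" by (simp add: q_def e_def)
  have "q = of_real (norm q) * cis a" using Arg2pi_eq[of q] a by (simp add: cis_conv_exp)
  also have "norm q = norm (e k) / norm (e (Suc k))" by (simp add: q norm_divide)
  finally have "- e k = of_real (norm (e k) / norm (e (Suc k))) * cis a * e (Suc k)"
    using q nz by (simp add: field_simps)
  then have ek: "e k = - (of_real (norm (e k) / norm (e (Suc k))) * cis a * e (Suc k))"
    by (metis minus_minus)
  define r where "r = norm (e (Suc k)) / norm (e k)"
  define r' where "r' = norm (e k) / norm (e (Suc k))"
  have "of_real r * cis (pi - a) * e k = of_real (r * r') * - (cis (pi - a) * cis a) * e (Suc k)"
    by (subst ek, fold r'_def) simp
  also have "cis (pi - a) * cis a = -1" by (simp add: cis_mult)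
  also have "r * r' = 1" using nz by (simp add: r_def r'_def)
  finally show "e (Suc k) = of_real (norm (e (Suc k)) / norm (e k)) * cis (pi - interior_angle vs (Suc k mod length vs)) * e k"
    by (simp add: a_def r_def)
qed

text \<open>The angle at a vertex fixes the direction of the next side from that of the previous
  one, so induction from side 0 gives all directions; admissibility makes them turn monotonically
  through exactly one full turn.\<close>

lemma admissible_imp_turning_polygon:
  assumes adm: "admissible_angles n (interior_angles vs)" and simple: "simple_path (boundary_path vs)"
  obtains u len where "simple_turning_polygon n (direction_angle (interior_angles vs)) vs u len"
proof -
  define psi where "psi = direction_angle (interior_angles vs)"
  define e where "e k = vertex vs (Suc k) - vertex vs k" for k
  define u where "u = e 0 / of_real (norm (e 0))"
  interpret turning n psi unfolding psi_def by (rule turning_direction_angle[OF adm])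
  have length: "length vs = n" using admissible_length[OF adm] by (simp add: interior_angles_def)
  have ang: "interior_angles vs ! k = interior_angle vs k" if "k < n" for k
    using that by (simp add: interior_angles_def length)
  have pos: "0 < interior_angle vs (Suc k mod n)" if "k < n" for k
    using admissible_nth[OF adm, of "Suc k mod n"] ang[of "Suc k mod n"] n_pos by simp
  note turn = interior_angle_turn[of _ vs, unfolded length, OF _ pos, folded e_def]
  have nz: "e k \<noteq> 0" if "k < n" for k using turn(1)[OF that that] .
  have side: "e k = of_real (norm (e k)) * (u * cis (psi k))" if "k < n" for k
    using that
  proof (induction k)
    case 0
    then show ?case using nz[of 0] by (simp add: u_def psi_0)
  next
    case (Suc k)
    have "psi (Suc k) = psi k + (pi - interior_angle vs (Suc k mod n))"
      using Suc ang[of "Suc k mod n"] by (simp add: psi_def direction_angle_def interior_angles_def length)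
    then have turned: "cis (psi (Suc k)) = cis (pi - interior_angle vs (Suc k mod n)) * cis (psi k)"
      by (simp add: cis_mult add.commute)
    have "e (Suc k) = of_real (norm (e (Suc k)) / norm (e k)) * cis (pi - interior_angle vs (Suc k mod n)) * e k"
      using turn(3)[of k] Suc by simp
    also have "\<dots> = of_real (norm (e (Suc k)) / norm (e k)) * cis (pi - interior_angle vs (Suc k mod n)) * (of_real (norm (e k)) * (u * cis (psi k)))"
      using Suc by simp
    also have "\<dots> = of_real (norm (e (Suc k)) / norm (e k) * norm (e k)) * (u * (cis (pi - interior_angle vs (Suc k mod n)) * cis (psi k)))"
      by (simp only: of_real_mult mult_ac)
    also have "norm (e (Suc k)) / norm (e k) * norm (e k) = norm (e (Suc k))" using nz[of k] Suc.prems by simp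
    finally show ?case by (simp only: turned)
  qed
  have "simple_turning_polygon n psi vs u (\<lambda>k. norm (e k))"
  proof unfold_locales
    show "3 \<le> n" by (rule admissible_ge_3[OF adm])
    show "norm u = 1" using nz[of 0] n_pos by (simp add: u_def norm_divide)
    show "vertex vs (Suc k) - vertex vs k = of_real (norm (e k)) * (u * cis (psi k))" if "k < n" for k
      using side[OF that] by (simp add: e_def)
  qed (use nz length simple in auto)
  then show ?thesis using that by (simp add: psi_def)
qed

context turning_polygon
begin

lemma side_Suc:
  assumes "k < n"
  obtains l where "0 < l" "vertex vs (Suc (Suc k)) - vertex vs (Suc k) = of_real l * (u * cis (psi (Suc k)))"
proof (cases "Suc k < n")
  case True
  then show ?thesis using that side len_pos by blast
next
  case False
  then have "Suc k = n" using assms by simp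
  \<comment> \<open>Side \<open>n\<close> is side 0, and \<open>cis (psi n) = cis (psi 0)\<close>
    after the full turn.\<close>
  then show ?thesis using that[of "len 0"] side[of 0] len_pos[of 0] n_pos vertex_n vertex_Suc_mod[of vs n]
    by (simp add: psi_0 psi_n length_vs)
qed

lemma interior_angle_eq:
  assumes "k < n"
  shows "interior_angle vs (Suc k mod n) = pi - (psi (Suc k) - psi k)"
proof -
  obtain l where l: "0 < l" "vertex vs (Suc (Suc k)) - vertex vs (Suc k) = of_real l * (u * cis (psi (Suc k)))"
    using side_Suc[OF assms] .
  have u: "u \<noteq> 0" using norm_u by auto
  define q where "q = (vertex vs k - vertex vs (Suc k)) / (vertex vs (Suc (Suc k)) - vertex vs (Suc k))"
  have "vertex vs k - vertex vs (Suc k) = - (of_real (len k) * (u * cis (psi k)))"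
    using side[OF assms] by (simp add: algebra_simps)
  then have "q = of_real (len k / l) * - (cis (psi k) / cis (psi (Suc k)))"
    unfolding q_def l(2) using u l(1) by simp
  also have "- (cis (psi k) / cis (psi (Suc k))) = cis pi * cis (psi k - psi (Suc k))"
    by (simp add: cis_divide)
  also have "\<dots> = cis (pi - (psi (Suc k) - psi k))" unfolding cis_mult by (simp add: algebra_simps)
  finally have "of_real (len k / l) * exp (\<i> * of_real (pi - (psi (Suc k) - psi k))) = q"
    by (simp add: cis_conv_exp)
  \<comment> \<open>The turn is at least 0 and below \<open>pi\<close>, so this angle lies in the
    range of \<open>Arg2pi\<close>.\<close>
  then have "Arg2pi q = pi - (psi (Suc k) - psi k)"
    by (rule Arg2pi_unique) (use l len_pos[OF assms] psi_step[OF assms] in auto)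
  then show ?thesis using interior_angle_vertex[of k vs] assms by (simp add: length_vs q_def)
qed

end

context simple_turning_polygon
begin

lemma area_pos: "0 < area vs"
proof -
  obtain c where c: "c \<in> core" using core_ne by blast
  have "0 < (\<Sum>k<n. len k * cross (dir k) (c - vertex vs k))"
    by (rule sum_pos) (use c n_pos len_pos in \<open>auto simp: core_def\<close>)
  then show ?thesis unfolding sum_len_cross_dir by (simp add: area_eq)
qed

lemma simple_turning_polygon_scale:
  assumes s: "0 < s"
  shows "simple_turning_polygon n psi (map (\<lambda>v. v /\<^sub>R s) vs) u (\<lambda>k. len k / s)"
proof unfold_locales
  define f where "f = (\<lambda>v::complex. v /\<^sub>R s)"
  have lin: "linear f" by (auto simp: f_def intro!: linearI simp: scaleR_add_right)
  have inj: "inj f" using s by (auto simp: f_def inj_def)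
  have "boundary_path (map f vs) = f \<circ> boundary_path vs"
    using polygonal_path_linear_image[OF lin, of "vs @ [hd vs]"] vs_ne
    by (simp add: boundary_path_def hd_map)
  then show "simple_path (boundary_path (map (\<lambda>v. v /\<^sub>R s) vs))"
    using simple simple_path_linear_image_eq[OF lin inj] by (simp add: f_def)
  fix k assume k: "k < n"
  have "vertex (map f vs) j = f (vertex vs j)" for j using vs_ne by (simp add: vertex_def)
  then have "vertex (map f vs) (Suc k) - vertex (map f vs) k = f (vertex vs (Suc k) - vertex vs k)"
    by (simp add: f_def algebra_simps)
  then show "vertex (map (\<lambda>v. v /\<^sub>R s) vs) (Suc k) - vertex (map (\<lambda>v. v /\<^sub>R s) vs) k = of_real (len k / s) * (u * cis (psi k))"
    unfolding side[OF k] by (simp add: f_def scaleR_conv_of_real field_simps)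
qed (use s n_ge_3 length_vs norm_u len_pos in auto)

lemma scale_to_unit_area:
  "area (scale_to_unit_area vs) = 1"
  "perimeter (scale_to_unit_area vs) = perimeter vs / sqrt (area vs)"
proof -
  define s where "s = sqrt (area vs)"
  have s: "0 < s" "s\<^sup>2 = area vs" using area_pos by (auto simp: s_def)
  interpret S: simple_turning_polygon n psi "map (\<lambda>v. v /\<^sub>R s) vs" u "\<lambda>k. len k / s"
    by (rule simple_turning_polygon_scale[OF s(1)])
  have sc: "scale_to_unit_area vs = map (\<lambda>v. v /\<^sub>R s) vs" by (simp add: scale_to_unit_area_def s_def)
  have "form (\<lambda>k. len k / s) (\<lambda>k. len k / s) = form len len / s\<^sup>2"
    by (simp add: form_def sum_divide_distrib power2_eq_square)
  then show "area (scale_to_unit_area vs) = 1"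
    unfolding sc S.area_eq using area_eq area_pos s by (simp add: field_simps)
  show "perimeter (scale_to_unit_area vs) = perimeter vs / sqrt (area vs)"
    unfolding sc S.perimeter_eq perimeter_eq by (simp add: s_def sum_divide_distrib)
qed

end

section \<open>Convexity of the cotangent\<close>

lemma sin_pos_half: "x \<in> {0<..pi / 2} \<Longrightarrow> 0 < sin (x::real)"
  by (intro sin_gt_zero) auto

lemma cot_deriv_strict_mono:
  assumes "0 < x" "x < y" "y \<le> pi / 2"
  shows "- inverse ((sin x)\<^sup>2) < - inverse ((sin y)\<^sup>2)"
proof -
  have "0 < sin x" "sin x < sin y" using assms by (auto intro: sin_gt_zero sin_monotone_2pi)
  then show ?thesis by (simp add: power_strict_mono)
qed

lemma cot_mvt:
  assumes "0 < x" "x < y" "y \<le> pi / 2"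
  obtains z where "x < z" "z < y" "cot y - cot x = (y - x) * - inverse ((sin z)\<^sup>2)"
proof -
  have "\<exists>z. x < z \<and> z < y \<and> cot y - cot x = (y - x) * - inverse ((sin z)\<^sup>2)"
  proof (rule MVT2[OF assms(2)])
    fix z assume "x \<le> z" "z \<le> y"
    then have "0 < sin z" using assms by (intro sin_pos_half) auto
    then show "(cot has_real_derivative - inverse ((sin z)\<^sup>2)) (at z)" by (intro DERIV_cot) simp
  qed
  then show ?thesis using that by blast
qed

lemma strictly_convex_on_cot: "strictly_convex_on {0<..pi / 2} cot"
proof -
  have lt: "cot ((1 - t) * x + t * y) < (1 - t) * cot x + t * cot y"
    if xy: "0 < x" "x < y" "y \<le> pi / 2" and t: "0 < t" "t < 1" for x y t :: real
  proof -
    define z where "z = (1 - t) * x + t * y"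
    have zx: "z - x = t * (y - x)" and yz: "y - z = (1 - t) * (y - x)" by (simp_all add: z_def algebra_simps)
    have "0 < z - x" "0 < y - z" unfolding zx yz using xy t by auto
    then have z: "x < z" "z < y" by auto
    obtain p where p: "x < p" "p < z" "cot z - cot x = (z - x) * - inverse ((sin p)\<^sup>2)"
      using cot_mvt[of x z] xy z by auto
    obtain q where q: "z < q" "q < y" "cot y - cot z = (y - z) * - inverse ((sin q)\<^sup>2)"
      using cot_mvt[of z y] xy z by auto
    define P Q where "P = - inverse ((sin p)\<^sup>2)" and "Q = - inverse ((sin q)\<^sup>2)"
    have "P < Q" unfolding P_def Q_def using p q xy by (intro cot_deriv_strict_mono) auto
    \<comment> \<open>Since \<open>t * (y - z)\<close> and \<open>(1 - t) * (z - x)\<close>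
      coincide, only the comparison of the two mean slopes \<open>P\<close> and \<open>Q\<close>
      remains.\<close>
    then have "0 < t * (1 - t) * (y - x) * (Q - P)" using xy t by simp
    also have "\<dots> = t * ((y - z) * Q) - (1 - t) * ((z - x) * P)" unfolding zx yz by (simp add: algebra_simps)
    also have "\<dots> = t * (cot y - cot z) - (1 - t) * (cot z - cot x)" using p q by (simp add: P_def Q_def)
    also have "\<dots> = (1 - t) * cot x + t * cot y - cot z" by (simp add: algebra_simps)
    finally show ?thesis by (simp add: z_def)
  qed
  show ?thesis unfolding strictly_convex_on_def
  proof (intro conjI ballI allI impI)
    fix x y t :: real assume *: "x \<in> {0<..pi / 2}" "y \<in> {0<..pi / 2}" "x \<noteq> y \<and> 0 < t \<and> t < 1"
    show "cot ((1 - t) * x + t * y) < (1 - t) * cot x + t * cot y"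
    proof (cases "x < y")
      case True then show ?thesis using lt * by auto
    next
      case False
      then show ?thesis using lt[of y x "1 - t"] * by (auto simp: add.commute)
    qed
  qed simp
qed

lemma cot_above_tangent:
  assumes "x \<in> {0<..pi / 2}" "y \<in> {0<..pi / 2}" "x \<noteq> y"
  shows "cot x + - inverse ((sin x)\<^sup>2) * (y - x) < cot y"
proof (cases "x < y")
  case True
  obtain z where z: "x < z" "z < y" "cot y - cot x = (y - x) * - inverse ((sin z)\<^sup>2)"
    using cot_mvt[of x y] assms True by auto
  have "- inverse ((sin x)\<^sup>2) < - inverse ((sin z)\<^sup>2)" using z assms by (intro cot_deriv_strict_mono) auto
  then have "(y - x) * - inverse ((sin x)\<^sup>2) < (y - x) * - inverse ((sin z)\<^sup>2)"
    using True by (intro mult_strict_left_mono) auto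
  then show ?thesis using z(3) mult.commute[of "- inverse ((sin x)\<^sup>2)" "y - x"] by linarith
next
  case False
  then have yx: "y < x" using assms by simp
  obtain z where z: "y < z" "z < x" "cot x - cot y = (x - y) * - inverse ((sin z)\<^sup>2)"
    using cot_mvt[of y x] assms yx by auto
  have "- inverse ((sin z)\<^sup>2) < - inverse ((sin x)\<^sup>2)" using z assms by (intro cot_deriv_strict_mono) auto
  then have "(x - y) * - inverse ((sin z)\<^sup>2) < (x - y) * - inverse ((sin x)\<^sup>2)"
    using yx by (intro mult_strict_left_mono) auto
  then show ?thesis using z by (simp add: algebra_simps)
qed

section \<open>Majorization and strictly convex functions\<close>

lemma abel_sum_nonneg:
  fixes w d :: "nat \<Rightarrow> real"
  assumes "\<And>i. Suc i < n \<Longrightarrow> w (Suc i) \<le> w i"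
    and "\<And>k. k \<le> n \<Longrightarrow> 0 \<le> (\<Sum>i<k. d i)" and "(\<Sum>i<n. d i) = 0"
  shows "0 \<le> (\<Sum>i<n. w i * d i)"
proof -
  \<comment> \<open>Summation by parts as an invariant: the last weight times the partial sum is a
    lower bound, and a smaller weight only lowers it because partial sums are nonnegative. At
    \<open>k = 0\<close> the truncated index is harmless, the sum being empty.\<close>
  have *: "w (k - 1) * (\<Sum>i<k. d i) \<le> (\<Sum>i<k. w i * d i)" if "k \<le> n" for k
    using that
  proof (induction k)
    case (Suc k)
    show ?case
    proof (cases k)
      case (Suc j)
      have "w k * (\<Sum>i<k. d i) \<le> w (k - 1) * (\<Sum>i<k. d i)"
        using Suc Suc.prems assms(1)[of j] assms(2)[of k] \<open>Suc k \<le> n\<close> by (intro mult_right_mono) auto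
      then show ?thesis using Suc.IH \<open>Suc k \<le> n\<close> by (simp add: algebra_simps)
    qed simp
  qed simp
  show ?thesis using *[of n] assms(3) by simp
qed

text \<open>
  Once both lists are sorted decreasingly, so are the slopes \<open>g a\<close> of the supporting lines, and summation
  by parts makes the sum of the linear lower bounds nonnegative.
\<close>

lemma karamata_strict:
  fixes f g :: "real \<Rightarrow> real"
  assumes tangent: "\<And>x y. x \<in> S \<Longrightarrow> y \<in> S \<Longrightarrow> x \<noteq> y \<Longrightarrow> f x + g x * (y - x) < f y"
    and mono: "\<And>x y. x \<in> S \<Longrightarrow> y \<in> S \<Longrightarrow> x \<le> y \<Longrightarrow> g x \<le> g y"
    and S: "set as \<subseteq> S" "set bs \<subseteq> S" and eq: "more_nearly_equal as bs"
  shows "(\<Sum>a\<leftarrow>as. f a) < (\<Sum>b\<leftarrow>bs. f b)"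
proof -
  define A B where "A = rev (sort as)" and "B = rev (sort bs)"
  define n where "n = length as"
  have lenA: "length A = n" "length B = n"
    using eq by (auto simp: A_def B_def n_def more_nearly_equal_def)
  have part: "(\<Sum>i<k. xs ! i) = sum_list (take k xs)" if "k \<le> length xs" for k and xs :: "real list"
    using sum_list_nth_lessThan[of "\<lambda>x. x" "take k xs"] that by simp
  have le: "(\<Sum>i<k. A ! i) \<le> (\<Sum>i<k. B ! i)" if "k \<le> n" for k
    using eq that lenA by (simp add: part more_nearly_equal_def A_def B_def n_def)
  have perm: "(\<Sum>i<n. h (A ! i)) = (\<Sum>a\<leftarrow>as. h a)" "(\<Sum>i<n. h (B ! i)) = (\<Sum>b\<leftarrow>bs. h b)" for h :: "real \<Rightarrow> real"
  proof -
    have "(\<Sum>a\<leftarrow>rev (sort xs). h a) = (\<Sum>a\<leftarrow>xs. h a)" for xs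
      by (metis mset_map mset_rev mset_sort sum_mset_sum_list)
    then show "(\<Sum>i<n. h (A ! i)) = (\<Sum>a\<leftarrow>as. h a)" "(\<Sum>i<n. h (B ! i)) = (\<Sum>b\<leftarrow>bs. h b)"
      using sum_list_nth_lessThan[of h A] sum_list_nth_lessThan[of h B] lenA by (simp_all add: A_def B_def)
  qed
  have tot: "(\<Sum>i<n. A ! i) = (\<Sum>i<n. B ! i)"
    using perm[of "\<lambda>x. x"] eq by (simp add: more_nearly_equal_def)
  have mem: "A ! i \<in> S" "B ! i \<in> S" if "i < n" for i
    using that S lenA nth_mem[of i A] nth_mem[of i B] by (auto simp: A_def B_def)
  have desc: "A ! Suc i \<le> A ! i" if "Suc i < n" for i
  proof -
    have "sorted (rev A)" by (simp add: A_def)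
    then show ?thesis using that lenA by (simp add: sorted_rev_nth_mono)
  qed
  have "0 \<le> (\<Sum>i<n. g (A ! i) * (B ! i - A ! i))"
    by (rule abel_sum_nonneg) (use le tot desc mem mono in \<open>auto simp: sum_subtractf\<close>)
  also have "\<dots> < (\<Sum>i<n. f (B ! i) - f (A ! i))"
  proof (rule sum_strict_mono_ex1)
    have "A \<noteq> B" using eq unfolding more_nearly_equal_def A_def B_def by (metis mset_rev mset_sort)
    then obtain i where "i < n" "A ! i \<noteq> B ! i" using lenA nth_equalityI by metis
    then show "\<exists>i\<in>{..<n}. g (A ! i) * (B ! i - A ! i) < f (B ! i) - f (A ! i)"
      using tangent[OF mem(1) mem(2), of i i] by (intro bexI[of _ i]) auto
    show "\<forall>i\<in>{..<n}. g (A ! i) * (B ! i - A ! i) \<le> f (B ! i) - f (A ! i)"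
    proof
      fix i assume "i \<in> {..<n}"
      then show "g (A ! i) * (B ! i - A ! i) \<le> f (B ! i) - f (A ! i)"
        using tangent[OF mem(1) mem(2), of i i] by (cases "A ! i = B ! i") auto
    qed
  qed simp
  also have "\<dots> = (\<Sum>b\<leftarrow>bs. f b) - (\<Sum>a\<leftarrow>as. f a)" by (simp add: sum_subtractf perm)
  finally show ?thesis by simp
qed

lemma sum_cot_less:
  assumes "admissible_angles n as" "admissible_angles n bs" "more_nearly_equal as bs"
  shows "(\<Sum>a\<leftarrow>as. cot (a / 2)) < (\<Sum>b\<leftarrow>bs. cot (b / 2))"
\<comment> \<open>\<open>g\<close> is the derivative of \<open>cot (x / 2)\<close>; its factor one
  half comes from the inner function.\<close>
proof (rule karamata_strict[where S = "{0<..pi}" and g = "\<lambda>x. - inverse ((sin (x / 2))\<^sup>2) / 2"])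
  show "cot (x / 2) + - inverse ((sin (x / 2))\<^sup>2) / 2 * (y - x) < cot (y / 2)"
    if "x \<in> {0<..pi}" "y \<in> {0<..pi}" "x \<noteq> y" for x y
    using cot_above_tangent[of "x / 2" "y / 2"] that by (simp add: algebra_simps diff_divide_distrib)
  show "- inverse ((sin (x / 2))\<^sup>2) / 2 \<le> - inverse ((sin (y / 2))\<^sup>2) / 2"
    if "x \<in> {0<..pi}" "y \<in> {0<..pi}" "x \<le> y" for x y
    using cot_deriv_strict_mono[of "x / 2" "y / 2"] that by (cases "x = y") auto
qed (use assms in \<open>auto simp: admissible_angles_def\<close>)

section \<open>Existence of circumscribed polygons\<close>

lemma polygonal_path_upt:
  "a + 2 < b \<Longrightarrow> polygonal_path (map V [a..<b]) =
    linepath (V a) (V (Suc a)) +++ polygonal_path (map V [Suc a..<b])"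
  by (simp add: upt_conv_Cons)

lemma path_image_polygonal_path_upt:
  assumes "a + 1 < b"
  shows "path_image (polygonal_path (map V [a..<b])) = (\<Union>j\<in>{j. a \<le> j \<and> Suc j < b}. closed_segment (V j) (V (Suc j)))"
proof -
  have "path_image (polygonal_path (map V [a..<b])) = (\<Union>i<b - a - 1. closed_segment (V (a + i)) (V (Suc (a + i))))"
    using assms by (subst path_image_polygonal_path) auto
  also have "\<dots> = (\<Union>j\<in>(\<lambda>i. a + i) ` {..<b - a - 1}. closed_segment (V j) (V (Suc j)))" by simp
  also have "(\<lambda>i. a + i) ` {..<b - a - 1} = {j. a \<le> j \<and> Suc j < b}"
  proof (intro equalityI subsetI)
    fix j assume "j \<in> {j. a \<le> j \<and> Suc j < b}"
    then show "j \<in> (\<lambda>i. a + i) ` {..<b - a - 1}" by (intro image_eqI[of _ _ "j - a"]) auto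
  qed auto
  finally show ?thesis .
qed

section \<open>Polygons whose vertices wind once around the origin are simple\<close>

lemma ray_angle_unique:
  assumes "of_real s * cis a = of_real t * cis b" "0 < s" "0 < t" "a \<le> b" "b \<le> a + 2 * pi"
  shows "s = t" "a = b \<or> b = a + 2 * pi"
proof -
  have "norm (of_real s * cis a) = norm (of_real t * cis b)" using assms(1) by simp
  then show st: "s = t" using assms(2,3) by (simp add: norm_mult)
  then have "cis a = cis b" using assms(1,2) by simp
  then have "sin b = sin a \<and> cos b = cos a" by (auto simp: cis.ctr)
  then obtain m :: int where m: "b = a + 2 * pi * m" using sin_cos_eq_iff by blast
  have "0 \<le> 2 * pi * m" "2 * pi * m \<le> 2 * pi" using assms m by auto
  then have "0 \<le> m" "m \<le> 1"
    using pi_gt_zero by (simp_all add: zero_le_mult_iff)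
  then show "a = b \<or> b = a + 2 * pi" using m by (cases "m = 0") auto
qed

text \<open>Confines a side to the sector spanned by its ends as seen from 0. The boundary rays meet
  the side only in its ends, so neighbouring sectors can share only a vertex.\<close>

lemma segment_angle:
  assumes a: "a = of_real p * cis \<beta>" "0 < p" and b: "b = of_real q * cis \<gamma>" "0 < q"
    and ang: "\<beta> < \<gamma>" "\<gamma> < \<beta> + pi" and x: "x \<in> closed_segment a b"
  obtains s \<phi> where "0 < s" "\<beta> \<le> \<phi>" "\<phi> \<le> \<gamma>" "x = of_real s * cis \<phi>" "\<phi> = \<beta> \<Longrightarrow> x = a" "\<phi> = \<gamma> \<Longrightarrow> x = b"
proof -
  obtain t where t: "0 \<le> t" "t \<le> 1" "x = (1 - t) *\<^sub>R a + t *\<^sub>R b" using x by (auto simp: closed_segment_def)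
  consider "t = 0" | "t = 1" | "0 < t" "t < 1" using t by linarith
  then show ?thesis
  proof cases
    case 1 then show ?thesis using that[of p \<beta>] a ang t by auto
  next
    case 2 then show ?thesis using that[of q \<gamma>] b ang t by auto
  next
    case 3
    define \<eta> where "\<eta> = \<gamma> - \<beta>"
    \<comment> \<open>\<open>y\<close> is \<open>x\<close> turned back so that \<open>a\<close>
      falls on the positive real axis. Then \<open>Im y > 0\<close>, and the negative sine below
      shows that \<open>y\<close> stays short of the ray of \<open>b\<close>.\<close>
    define y where "y = of_real ((1 - t) * p) + of_real (t * q) * cis \<eta>"
    have xy: "x = y * cis \<beta>"
      unfolding t(3) a b y_def by (simp add: \<eta>_def scaleR_conv_of_real distrib_right cis_mult mult.assoc)
    have sn: "0 < sin \<eta>" using ang by (intro sin_gt_zero) (auto simp: \<eta>_def)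
    have "0 < Im y" using 3 b sn by (simp add: y_def)
    then have y0: "y \<noteq> 0" and Ay: "0 < Arg y" "Arg y < pi" using Arg_lt_pi[of y] by auto
    have ycis: "y = of_real (norm y) * cis (Arg y)" using y0 rcis_cmod_Arg[of y] by (simp add: rcis_def)
    have "norm y * sin (Arg y - \<eta>) = Im (y * cis (- \<eta>))"
      by (subst (3) ycis) (simp add: sin_diff algebra_simps)
    also have "\<dots> = - ((1 - t) * p * sin \<eta>)"
      by (simp add: y_def algebra_simps)
    also have "\<dots> < 0" using 3 a sn by simp
    finally have "sin (Arg y - \<eta>) < 0" using y0 by (simp add: mult_less_0_iff)
    moreover have "0 \<le> sin (Arg y - \<eta>)" if "\<eta> \<le> Arg y"
      using that Ay ang by (intro sin_ge_zero) (auto simp: \<eta>_def)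
    ultimately have "Arg y < \<eta>" by force
    moreover have "x = of_real (norm y) * cis (\<beta> + Arg y)"
      unfolding xy by (subst ycis) (simp add: cis_mult add.commute mult.assoc)
    ultimately show ?thesis using that[of "norm y" "\<beta> + Arg y"] y0 Ay by (auto simp: \<eta>_def)
  qed
qed

context
  fixes n :: nat and V :: "nat \<Rightarrow> complex" and \<rho> \<beta> :: "nat \<Rightarrow> real"
  assumes V: "\<And>k. k \<le> n \<Longrightarrow> V k = of_real (\<rho> k) * cis (\<beta> k)"
    and \<rho>: "\<And>k. k \<le> n \<Longrightarrow> 0 < \<rho> k"
    and \<beta>: "\<And>k. k < n \<Longrightarrow> \<beta> k < \<beta> (Suc k)" "\<And>k. k < n \<Longrightarrow> \<beta> (Suc k) < \<beta> k + pi"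
    and around: "\<beta> n = \<beta> 0 + 2 * pi" and closed: "V n = V 0"
begin

lemma star_mono: "i \<le> j \<Longrightarrow> j \<le> n \<Longrightarrow> \<beta> i \<le> \<beta> j"
proof (induction j rule: dec_induct)
  case (step j)
  then show ?case using \<beta>(1)[of j] by auto
qed auto

text \<open>Different sides lie in sectors that share at most boundary rays: the one at vertex
  \<open>Suc i\<close> or, after a full turn, the one at vertex 0.\<close>

lemma star_sides_meet:
  assumes ij: "i < j" "j < n"
    and x: "x \<in> closed_segment (V i) (V (Suc i))" "x \<in> closed_segment (V j) (V (Suc j))"
  shows "x = V (Suc i) \<or> (i = 0 \<and> x = V 0)"
proof -
  obtain s \<phi> where s: "0 < s" "\<beta> i \<le> \<phi>" "\<phi> \<le> \<beta> (Suc i)" "x = of_real s * cis \<phi>" "\<phi> = \<beta> i \<Longrightarrow> x = V i" "\<phi> = \<beta> (Suc i) \<Longrightarrow> x = V (Suc i)"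
    by (rule segment_angle[OF V \<rho> V \<rho> \<beta> x(1)]) (use ij in auto)
  obtain t \<theta> where t: "0 < t" "\<beta> j \<le> \<theta>" "\<theta> \<le> \<beta> (Suc j)" "x = of_real t * cis \<theta>"
    by (rule segment_angle[OF V \<rho> V \<rho> \<beta> x(2)]) (use ij in auto)
  have le: "\<phi> \<le> \<beta> (Suc i)" "\<beta> (Suc i) \<le> \<theta>" using s t star_mono[of "Suc i" j] ij by auto
  have le2: "\<theta> \<le> \<beta> 0 + 2 * pi" "\<beta> 0 + 2 * pi \<le> \<phi> + 2 * pi"
    using s t star_mono[of "Suc j" n] star_mono[of 0 i] ij around by auto
  have "\<phi> = \<theta> \<or> \<theta> = \<phi> + 2 * pi"
    by (rule ray_angle_unique(2)[of s \<phi> t \<theta>]) (use s t le le2 in auto)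
  then show ?thesis
  proof
    assume "\<phi> = \<theta>"
    then show ?thesis using s le by auto
  next
    assume "\<theta> = \<phi> + 2 * pi"
    then have "\<phi> = \<beta> 0" using le2 by simp
    moreover have "i = 0"
    proof (rule ccontr)
      assume "i \<noteq> 0"
      then have "\<beta> 0 < \<beta> (Suc 0)" "\<beta> (Suc 0) \<le> \<beta> i" using \<beta>(1)[of 0] star_mono[of "Suc 0" i] ij by auto
      then show False using s calculation by simp
    qed
    ultimately show ?thesis using s by auto
  qed
qed

lemma star_side_ne: "k < n \<Longrightarrow> V k \<noteq> V (Suc k)"
proof
  assume k: "k < n" and eq: "V k = V (Suc k)"
  have "of_real (\<rho> k) * cis (\<beta> k) = of_real (\<rho> (Suc k)) * cis (\<beta> (Suc k))"
    using V[of k] V[of "Suc k"] eq k by simp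
  then have "\<beta> k = \<beta> (Suc k) \<or> \<beta> (Suc k) = \<beta> k + 2 * pi"
    by (rule ray_angle_unique(2)) (use k \<rho>[of k] \<rho>[of "Suc k"] \<beta>[OF k] in auto)
  then show False using \<beta>[OF k] by auto
qed

text \<open>Starting after vertex 0 removes the coincidence \<open>V n = V 0\<close>, so a side
  meets the later ones only in its own end point, and sides can be prepended one by one.\<close>

lemma arc_star_path:
  assumes "0 < a" "a < n"
  shows "arc (polygonal_path (map V [a..<Suc n]))"
proof -
  have "\<forall>a. 0 < a \<longrightarrow> a < n \<longrightarrow> n - a = m \<longrightarrow> arc (polygonal_path (map V [a..<Suc n]))" for m
  proof (induction m)
    case (Suc m)
    show ?case
    proof (intro allI impI)
      fix a assume a: "0 < a" "a < n" "n - a = Suc m"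
      show "arc (polygonal_path (map V [a..<Suc n]))"
      proof (cases "Suc a = n")
        case True
        then have "map V [a..<Suc n] = [V a, V n]" by (auto simp: upt_conv_Cons)
        then show ?thesis using star_side_ne[of a] True a by simp
      next
        case False
        then have arc: "arc (polygonal_path (map V [Suc a..<Suc n]))" using Suc.IH a by auto
        have sub: "closed_segment (V a) (V (Suc a)) \<inter> path_image (polygonal_path (map V [Suc a..<Suc n])) \<subseteq> {V (Suc a)}"
        proof
          fix x assume x: "x \<in> closed_segment (V a) (V (Suc a)) \<inter> path_image (polygonal_path (map V [Suc a..<Suc n]))"
          then obtain j where "Suc a \<le> j" "j < n" "x \<in> closed_segment (V j) (V (Suc j))"
            using a False by (subst (asm) path_image_polygonal_path_upt) auto
          then show "x \<in> {V (Suc a)}" using star_sides_meet[of a j x] x a by auto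
        qed
        have start: "pathstart (polygonal_path (map V [Suc a..<Suc n])) = V (Suc a)"
          using a by (simp add: pathstart_polygonal_path hd_map del: upt_Suc)
        show ?thesis
          using a False arc sub star_side_ne[of a] start
          by (subst polygonal_path_upt) (auto simp: arc_join_eq simp del: upt_Suc)
      qed
    qed
  qed auto
  then show ?thesis using assms by blast
qed

lemma simple_star_path:
  assumes "2 \<le> n"
  shows "simple_path (polygonal_path (map V [0..<Suc n]))"
proof -
  have sub: "closed_segment (V 0) (V (Suc 0)) \<inter> path_image (polygonal_path (map V [Suc 0..<Suc n])) \<subseteq> {V 0, V (Suc 0)}"
  proof
    fix x assume x: "x \<in> closed_segment (V 0) (V (Suc 0)) \<inter> path_image (polygonal_path (map V [Suc 0..<Suc n]))"
    then obtain j where "Suc 0 \<le> j" "j < n" "x \<in> closed_segment (V j) (V (Suc j))"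
      using assms by (subst (asm) path_image_polygonal_path_upt) auto
    then show "x \<in> {V 0, V (Suc 0)}" using star_sides_meet[of 0 j x] x by auto
  qed
  have ends: "pathstart (polygonal_path (map V [Suc 0..<Suc n])) = V (Suc 0)"
    "pathfinish (polygonal_path (map V [Suc 0..<Suc n])) = V 0"
    using assms closed by (auto simp: pathstart_polygonal_path pathfinish_polygonal_path hd_map last_map simp del: upt_Suc)
  show ?thesis
    using assms arc_star_path[of "Suc 0"] star_side_ne[of 0] sub ends
    by (subst polygonal_path_upt) (auto simp: simple_path_join_loop_eq simp del: upt_Suc)
qed

end

context simple_turning_polygon
begin

text \<open>Inside a simple closed path the winding number is 1 or -1; an inside point sees all
  sides on its left, which makes it positive.\<close>

lemma ngon: "ngon n vs"
  unfolding ngon_def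
proof (intro conjI ballI)
  fix z assume z: "z \<in> inside (path_image (boundary_path vs))"
  then have "0 < Re (winding_number (boundary_path vs) z)"
    using winding_number_core(2) inside_eq_core by simp
  then show "winding_number (boundary_path vs) z = 1"
    using z by (cases rule: simple_closed_path_winding_number_inside[OF simple]) auto
qed (use n_ge_3 length_vs simple in auto)

end

text \<open>
  The vertices are placed at angular offsets \<open>gam k\<close> from the direction of the point of contact of
  side \<open>k\<close>. Where the polygon turns by \<open>ext k > 0\<close> the offset must be \<open>- ext k / 2\<close>; the vertices with straight
  angles are spread over the short interval \<open>(- d, 0)\<close> in cyclic order, starting after a proper corner \<open>c\<close>.
\<close>

lemma vertex_offsets:
  fixes ext :: "nat \<Rightarrow> real"
  assumes n: "0 < n" and ext: "\<And>k. 0 \<le> ext k" "\<And>k. ext k < pi" and per: "\<And>k. ext (k mod n) = ext k"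
    and turn: "\<exists>k<n. 0 < ext k"
  obtains gam :: "nat \<Rightarrow> real" where "\<And>k. gam (k mod n) = gam k" "\<And>k. - pi / 2 < gam k" "\<And>k. gam k < 0"
    "\<And>k. 0 < ext k \<Longrightarrow> gam k = - ext k / 2" "\<And>k. gam k < gam (Suc k) + ext (Suc k)"
proof -
  obtain c where c: "c < n" "0 < ext c" using turn by blast
  define D where "D = (\<lambda>k. ext k / 2) ` {k. k < n \<and> 0 < ext k}"
  \<comment> \<open>Half the smallest proper turn: the offsets of straight vertices, being at least
    \<open>- d\<close>, are then never below the offset of a corner.\<close>
  define d where "d = Min D"
  have D: "finite D" "D \<noteq> {}" using c by (auto simp: D_def)
  have dle: "d \<le> ext k / 2" if "0 < ext k" for k
    unfolding d_def using D(1)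
  proof (rule Min_le)
    have "ext (k mod n) / 2 \<in> D" unfolding D_def using that n per[of k] by (intro imageI) auto
    then show "ext k / 2 \<in> D" by (simp add: per)
  qed
  have d: "0 < d" using Min_in[OF D] by (auto simp: d_def D_def)
  have dpi: "d < pi / 2" using dle[OF c(2)] ext(2)[of c] by simp
  \<comment> \<open>The position counted cyclically from the corner \<open>c\<close>. The count
    wraps only at \<open>c\<close>, so along a run of straight angles it grows by one at each
    step.\<close>
  define m where "m k = (k + (n - c)) mod n" for k
  have m: "m k < n" for k using n by (simp add: m_def)
  have mper: "m (k mod n) = m k" for k by (simp add: m_def mod_add_left_eq)
  have mSuc: "m (Suc k) = Suc (m k)" if "ext (Suc k) = 0" for k
  proof -
    have "m (Suc k) \<noteq> 0"
    proof
      assume "m (Suc k) = 0"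
      then have "(Suc k + (n - c) + c) mod n = c mod n" unfolding m_def by (metis add_0 mod_add_left_eq)
      moreover have "Suc k + (n - c) + c = Suc k + n" using c by simp
      ultimately have "Suc k mod n = c" using c by (simp only: mod_add_self2 mod_less)
      then show False using that per[of "Suc k"] c by simp
    qed
    then show ?thesis unfolding m_def by (simp add: mod_Suc split: if_splits)
  qed
  define gam where "gam k = (if 0 < ext k then - ext k / 2 else - d + d * real (m k) / real n)" for k
  have small: "- d \<le> - d + d * real (m k) / real n" "- d + d * real (m k) / real n < 0" for k
    using d n m[of k] by (simp_all add: field_simps)
  show ?thesis
  proof (rule that[of gam])
    show "gam (k mod n) = gam k" for k by (simp add: gam_def per mper)
    show "- pi / 2 < gam k" for k using ext(2)[of k] small(1)[of k] dpi by (auto simp: gam_def)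
    show neg: "gam k < 0" for k using small(2)[of k] by (simp add: gam_def)
    show "gam k = - ext k / 2" if "0 < ext k" for k using that by (simp add: gam_def)
    show "gam k < gam (Suc k) + ext (Suc k)" for k
    proof (cases "0 < ext (Suc k)")
      case True
      then show ?thesis using neg[of k] by (simp add: gam_def)
    next
      case False
      then have e0: "ext (Suc k) = 0" using ext(1)[of "Suc k"] by simp
      have g: "gam (Suc k) = - d + d * real (m k) / real n + d / real n"
        using e0 mSuc[OF e0] by (simp add: gam_def add_divide_distrib distrib_left)
      have "0 < d / real n" "0 \<le> d * real (m k) / real n" using d n by auto
      then show ?thesis using g e0 dle[of k] by (auto simp: gam_def)
    qed
  qed
qed

text \<open>Angular offsets settle tangency and simplicity together: the tangent of the offset gives
  a point on the tangent line of side \<open>k\<close>, and adding \<open>psi k\<close> gives its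
  polar angle up to a constant, which increases with \<open>k\<close>.\<close>

theorem circumscribed_polygon_exists:
  assumes adm: "admissible_angles n as"
  obtains P where "ngon n P" "interior_angles P = as" "circumscribed_unit_circle P"
proof -
  define psi where "psi = direction_angle as"
  interpret turning n psi unfolding psi_def by (rule turning_direction_angle[OF adm])
  have n3: "3 \<le> n" by (rule admissible_ge_3[OF adm])
  define ext where "ext k = pi - as ! (k mod n)" for k
  have psiS: "psi (Suc k) = psi k + ext (Suc k)" for k
    by (simp add: psi_def direction_angle_def ext_def admissible_length[OF adm])
  have ext: "0 \<le> ext k" "ext k < pi" for k
    using admissible_nth[OF adm, of "k mod n"] n_pos by (simp_all add: ext_def)
  have per: "ext (k mod n) = ext k" for k by (simp add: ext_def)
  have "\<exists>k<n. 0 < ext k"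
  proof -
    obtain k where k: "Suc k < n" "psi k = 0" "0 < psi (Suc k)" using exists_first_turn by blast
    then show ?thesis using psiS[of k] by auto
  qed
  then obtain gam where gam: "\<And>k. gam (k mod n) = gam k" "\<And>k. - pi / 2 < gam k" "\<And>k. gam k < 0"
    "\<And>k. 0 < ext k \<Longrightarrow> gam k = - ext k / 2" "\<And>k. gam k < gam (Suc k) + ext (Suc k)"
    using vertex_offsets[of n ext, OF n_pos ext per] by blast
  have gam_le: "gam k + ext k < pi / 2" for k
  proof (cases "0 < ext k")
    case True
    then show ?thesis using gam(4)[of k] ext(2)[of k] by simp
  next
    case False
    then show ?thesis using gam(3)[of k] pi_gt_zero by linarith
  qed
  have cosg: "0 < cos (gam k)" for k using gam(2,3)[of k] by (intro cos_gt_zero_pi) auto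
  define V where "V k = (- \<i> + of_real (tan (gam k))) * cis (psi k)" for k
  have VSuc: "V (Suc k) = (- \<i> + of_real (tan (gam (Suc k) + ext (Suc k)))) * cis (psi k)" for k
  proof (cases "0 < ext (Suc k)")
    case True
    have "0 < cos (ext (Suc k) / 2)" using ext[of "Suc k"] by (intro cos_gt_zero_pi) auto
    then have "(- \<i> - of_real (tan (ext (Suc k) / 2))) * cis (ext (Suc k)) = - \<i> + of_real (tan (ext (Suc k) / 2))"
      by (intro tan_half_rotation) simp
    moreover have "cis (psi (Suc k)) = cis (ext (Suc k)) * cis (psi k)"
      by (simp add: psiS cis_mult add.commute)
    ultimately show ?thesis using gam(4)[OF True]
      by (simp add: V_def mult.assoc[symmetric])
  next
    case False
    then have "ext (Suc k) = 0" using ext(1)[of "Suc k"] by simp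
    then show ?thesis by (simp add: V_def psiS)
  qed
  have Vn: "V n = V 0" using gam(1)[of n] by (simp add: V_def psi_0 psi_n)
  \<comment> \<open>Measured from the point of contact of side \<open>k\<close>, its ends have the
    angular offsets \<open>gam k\<close> and \<open>gam (Suc k) + ext (Suc k)\<close>.\<close>
  define len where "len k = tan (gam (Suc k) + ext (Suc k)) - tan (gam k)" for k
  have len: "0 < len k" for k
    unfolding len_def using gam(2)[of k] gam(5)[of k] gam_le[of "Suc k"] by (simp add: tan_monotone)
  have step: "V (Suc k) - V k = of_real (len k) * cis (psi k)" for k
    unfolding VSuc by (simp add: V_def len_def algebra_simps)
  define vs where "vs = map V [0..<n]"
  have length: "length vs = n" by (simp add: vs_def)
  have vertex: "vertex vs k = V k" if "k \<le> n" for k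
    using that n_pos Vn by (cases "k = n") (auto simp: vertex_def vs_def)
  interpret turning_polygon n psi vs 1 len
    by unfold_locales (use n3 length len step vertex in auto)
  define \<rho> where "\<rho> k = inverse (cos (gam k))" for k
  \<comment> \<open>The shift by \<open>pi / 2\<close> appears because side 0 touches the circle at
    \<open>- \<i>\<close>.\<close>
  define \<beta> where "\<beta> k = psi k + gam k - pi / 2" for k
  have V: "V k = of_real (\<rho> k) * cis (\<beta> k)" for k
  proof -
    have c: "cos (gam k) \<noteq> 0" using cosg[of k] by simp
    have "of_real (\<rho> k) * cis (gam k - pi / 2) = - \<i> + of_real (tan (gam k))"
    proof -
      have "cis (gam k - pi / 2) = Complex (sin (gam k)) (- cos (gam k))"
        unfolding cis.ctr by (simp add: cos_diff sin_diff)
      moreover have "\<rho> k * sin (gam k) = tan (gam k)" "\<rho> k * cos (gam k) = 1"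
        using c unfolding \<rho>_def tan_def by (simp_all add: field_simps)
      ultimately show ?thesis by (simp add: complex_eq_iff)
    qed
    moreover have "cis (\<beta> k) = cis (gam k - pi / 2) * cis (psi k)"
      by (simp add: \<beta>_def cis_mult algebra_simps)
    ultimately show ?thesis by (simp add: V_def mult.assoc[symmetric])
  qed
  have "gam n = gam 0" using gam(1)[of n] by simp
  then have around: "\<beta> n = \<beta> 0 + 2 * pi" by (simp add: \<beta>_def psi_0 psi_n)
  have simp_star: "simple_path (polygonal_path (map V [0..<Suc n]))"
  proof (rule simple_star_path[of n V \<rho> \<beta>])
    fix k show "\<beta> k < \<beta> (Suc k)" using gam(5)[of k] by (simp add: \<beta>_def psiS)
    show "\<beta> (Suc k) < \<beta> k + pi" using gam_le[of "Suc k"] gam(2)[of k] by (simp add: \<beta>_def psiS)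
  qed (use V cosg around Vn n3 in \<open>auto simp: \<rho>_def\<close>)
  have "vs @ [hd vs] = map V [0..<Suc n]" using n_pos Vn by (simp add: vs_def hd_map)
  then have simple: "simple_path (boundary_path vs)" using simp_star by (simp only: boundary_path_def)
  interpret simple_turning_polygon n psi vs 1 len by unfold_locales (rule simple)
  have "cross (dir k) (0 - vertex vs k) = 1" if "k < n" for k
  proof -
    have "cross (dir k) (0 - vertex vs k) = - cross (cis (psi k) * 1) (cis (psi k) * (- \<i> + of_real (tan (gam k))))"
      using that by (simp add: vertex V_def dir_def cross_minus mult.commute)
    also have "\<dots> = - cross 1 (- \<i> + of_real (tan (gam k)))" by (subst cross_mult_unit) auto
    finally show ?thesis by (simp add: cross_def)
  qed
  then have "circumscribed_unit_circle vs"
    unfolding circumscribed_unit_circle_def using circumscribed_iff[of 1 0] by auto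
  moreover have "interior_angles vs = as"
  proof (rule nth_equalityI)
    show "length (interior_angles vs) = length as"
      by (simp add: interior_angles_def length admissible_length[OF adm])
    fix i assume "i < length (interior_angles vs)"
    then have i: "i < n" by (simp add: interior_angles_def length)
    define k where "k = (if i = 0 then n - 1 else i - 1)"
    have k: "k < n" "Suc k mod n = i" using i n_pos by (auto simp: k_def)
    have "interior_angle vs (Suc k mod n) = as ! i"
      unfolding interior_angle_eq[OF k(1)] using k psiS[of k] by (simp add: ext_def)
    then show "interior_angles vs ! i = as ! i" using k i by (simp add: interior_angles_def length)
  qed
  ultimately show ?thesis using that ngon by blast
qed

section \<open>Consequences for polygons with admissible angles\<close>

lemma admissible_ngon:
  assumes "ngon n P" "interior_angles P = as" "admissible_angles n as"
  obtains u len where "simple_turning_polygon n (direction_angle as) P u len"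
  using admissible_imp_turning_polygon[of n P] assms by (auto simp: ngon_def)

lemma admissible_angles_mset:
  assumes "admissible_angles n as" "mset bs = mset as"
  shows "admissible_angles n bs"
proof -
  have "sum_list bs = sum_list as" using arg_cong[OF assms(2), of sum_mset] by (simp add: sum_mset_sum_list)
  then show ?thesis
    using assms(1) mset_eq_length[OF assms(2)] mset_eq_setD[OF assms(2)] by (simp add: admissible_angles_def)
qed

lemma circumscribed_ngon_area_perimeter:
  assumes "ngon n P" "interior_angles P = as" "admissible_angles n as" "circumscribed_unit_circle P"
  shows "area P = (\<Sum>a\<leftarrow>as. cot (a / 2))" "perimeter P = 2 * (\<Sum>a\<leftarrow>as. cot (a / 2))"
    "area (scale_to_unit_area P) = 1"
    "perimeter (scale_to_unit_area P) = 2 * sqrt (\<Sum>a\<leftarrow>as. cot (a / 2))"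
proof -
  obtain u len where "simple_turning_polygon n (direction_angle as) P u len"
    using admissible_ngon[OF assms(1-3)] .
  then interpret simple_turning_polygon n "direction_angle as" P u len .
  show a: "area P = (\<Sum>a\<leftarrow>as. cot (a / 2))" and p: "perimeter P = 2 * (\<Sum>a\<leftarrow>as. cot (a / 2))"
    using circumscribed_area_perimeter[OF assms(4)] total_tan_direction_angle[OF assms(3)] by simp_all
  show "area (scale_to_unit_area P) = 1" by (rule scale_to_unit_area)
  show "perimeter (scale_to_unit_area P) = 2 * sqrt (\<Sum>a\<leftarrow>as. cot (a / 2))"
    unfolding scale_to_unit_area p a[symmetric] using real_div_sqrt[of "area P"] area_pos
    by (simp only: times_divide_eq_right[symmetric] less_imp_le)
qed

text \<open>By \<open>S\<close> the area equals \<open>total_tan\<close> for the directions of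
  \<open>Q\<close> itself, so Lhuilier's inequality compares the squares of
  \<open>2 * area Q\<close> and \<open>perimeter Q\<close>, and in the case of equality the
  inscribed radius is 1.\<close>

lemma ngon_perimeter_bound:
  assumes Q: "ngon n Q" "admissible_angles n (interior_angles Q)"
    and S: "area Q = (\<Sum>a\<leftarrow>interior_angles Q. cot (a / 2))"
  shows "2 * area Q \<le> perimeter Q" "perimeter Q = 2 * area Q \<longleftrightarrow> circumscribed_unit_circle Q"
proof -
  obtain u len where "simple_turning_polygon n (direction_angle (interior_angles Q)) Q u len"
    using admissible_ngon[OF Q(1) refl Q(2)] .
  then interpret simple_turning_polygon n "direction_angle (interior_angles Q)" Q u len .
  have T: "area Q = total_tan" using S total_tan_direction_angle[OF Q(2)] by simp
  have "0 \<le> perimeter Q" by (simp add: perimeter_def sum_nonneg)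
  moreover have "(2 * area Q)\<^sup>2 \<le> (perimeter Q)\<^sup>2"
    using lhuilier_perimeter T by (simp add: power2_eq_square)
  ultimately show "2 * area Q \<le> perimeter Q" by (rule power2_le_imp_le[rotated])
  show "perimeter Q = 2 * area Q \<longleftrightarrow> circumscribed_unit_circle Q"
    using lhuilier_equality circumscribed_area_perimeter T by auto
qed

text \<open>The competitors may have the angles in any order, as the bound depends only on the sum
  of \<open>cot (a / 2)\<close>. A circumscribed competitor with another order attains the same
  perimeter at equal area, so congruence is asserted only for the order \<open>as\<close>.\<close>

theorem proposition3p1:
  fixes n :: nat and as :: "real list"
  assumes "admissible_angles n as"
  shows
    "(\<exists>P. ngon n P \<and> interior_angles P = as \<and> circumscribed_unit_circle P) \<and>
     (\<forall>P P'. ngon n P \<and> interior_angles P = as \<and> circumscribed_unit_circle P \<and>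
             ngon n P' \<and> interior_angles P' = as \<and> circumscribed_unit_circle P' \<longrightarrow>
        congruent_polygons P P') \<and>
     (\<forall>P. ngon n P \<and> interior_angles P = as \<and> circumscribed_unit_circle P \<longrightarrow>
        (\<forall>Q. ngon n Q \<and> mset (interior_angles Q) = mset as \<and> area Q = area P \<longrightarrow>
           perimeter P \<le> perimeter Q \<and>
           (perimeter Q = perimeter P \<longleftrightarrow> circumscribed_unit_circle Q) \<and>
           (perimeter Q = perimeter P \<and> interior_angles Q = as \<longrightarrow> congruent_polygons P Q)) \<and>
        area (scale_to_unit_area P) = 1 \<and>
        perimeter (scale_to_unit_area P) = 2 * sqrt (\<Sum>a\<leftarrow>as. cot (a / 2))) \<and>
     strictly_convex_on {0<..pi / 2} cot \<and>
     (\<forall>bs P Q. admissible_angles n bs \<and> more_nearly_equal as bs \<and>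
               ngon n P \<and> interior_angles P = as \<and> circumscribed_unit_circle P \<and>
               ngon n Q \<and> interior_angles Q = bs \<and> circumscribed_unit_circle Q \<longrightarrow>
        perimeter (scale_to_unit_area P) < perimeter (scale_to_unit_area Q))"
proof (intro conjI allI impI; (elim conjE)?)
  note adm = assms
  define C where "C = (\<Sum>a\<leftarrow>as. cot (a / 2))"
  have cong: "congruent_polygons P Q"
    if "ngon n P" "interior_angles P = as" "circumscribed_unit_circle P"
      "ngon n Q" "interior_angles Q = as" "circumscribed_unit_circle Q" for P Q
    using admissible_ngon[OF that(1,2) adm] admissible_ngon[OF that(4,5) adm]
      turning_polygons_congruent that(3,6) by metis
  show "\<exists>P. ngon n P \<and> interior_angles P = as \<and> circumscribed_unit_circle P"
    using circumscribed_polygon_exists[OF adm] by metis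
  show "congruent_polygons P P'"
    if "ngon n P" "interior_angles P = as" "circumscribed_unit_circle P"
      "ngon n P'" "interior_angles P' = as" "circumscribed_unit_circle P'" for P P'
    using cong that .
  show "strictly_convex_on {0<..pi / 2} cot" by (rule strictly_convex_on_cot)
  show "area (scale_to_unit_area P) = 1"
    "perimeter (scale_to_unit_area P) = 2 * sqrt (\<Sum>a\<leftarrow>as. cot (a / 2))"
    if "ngon n P" "interior_angles P = as" "circumscribed_unit_circle P" for P
    using circumscribed_ngon_area_perimeter[OF that(1,2) adm that(3)] by auto
  show "perimeter (scale_to_unit_area P) < perimeter (scale_to_unit_area Q)"
    if "admissible_angles n bs" "more_nearly_equal as bs"
      "ngon n P" "interior_angles P = as" "circumscribed_unit_circle P"
      "ngon n Q" "interior_angles Q = bs" "circumscribed_unit_circle Q" for bs P Q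
    using circumscribed_ngon_area_perimeter(4)[OF that(3,4) adm that(5)]
      circumscribed_ngon_area_perimeter(4)[OF that(6,7,1,8)] sum_cot_less[OF adm that(1,2)] by simp
  fix P Q
  assume P: "ngon n P" "interior_angles P = as" "circumscribed_unit_circle P"
    and Q: "ngon n Q" "mset (interior_angles Q) = mset as" "area Q = area P"
  have admQ: "admissible_angles n (interior_angles Q)" by (rule admissible_angles_mset[OF adm Q(2)])
  have "(\<Sum>a\<leftarrow>interior_angles Q. cot (a / 2)) = (\<Sum>a\<leftarrow>as. cot (a / 2))"
    using Q(2) by (metis mset_map sum_mset_sum_list)
  note area_P = circumscribed_ngon_area_perimeter(1,2)[OF P(1,2) adm P(3)]
  then have S: "area Q = (\<Sum>a\<leftarrow>interior_angles Q. cot (a / 2))"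
    using Q(3) \<open>(\<Sum>a\<leftarrow>interior_angles Q. cot (a / 2)) = (\<Sum>a\<leftarrow>as. cot (a / 2))\<close> by simp
  have eqP: "perimeter P = 2 * area Q" using area_P Q(3) by simp
  note bound = ngon_perimeter_bound[OF Q(1) admQ S]
  show "perimeter P \<le> perimeter Q" using bound(1) eqP by simp
  show iff: "perimeter Q = perimeter P \<longleftrightarrow> circumscribed_unit_circle Q" using bound(2) eqP by simp
  show "congruent_polygons P Q" if "perimeter Q = perimeter P" "interior_angles Q = as"
    using cong P Q(1) that iff by blast
qed

end
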